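(* Assume that $V\in\mathcal{V}$. There exists a positive constant $C_{\rm Nash}^\sharp$ such that for every $f\in D(S^{1/2})\cap L^1(\mathbb{R},d\mu_V)$, $$\|f\|_{L^2}^{2+4/3}\le C_{\rm Nash}^\sharp\,\|\psi_Vf\|_{L^1}^{4/3}\,\|S^{1/2}f\|_{L^2}^{2}.$$
   Context: All functions are real-valued and $L^p=L^p(\mathbb{R})$. $BC(\mathbb{R})$ is the set of bounded continuous functions on $\mathbb{R}$, and $\mathcal{V}=\{V\in BC(\mathbb{R}) : V\ge 0,\ 0<\int_{\mathbb{R}}|x|V(x)\,dx<+\infty\}$. For $V\in\mathcal{V}$, $S=-\frac{d^2}{dx^2}+V$ is the nonnegative selfadjoint operator in $L^2(\mathbb{R})$ with domain $D(S)=H^2(\mathbb{R})$; then $D(S^{1/2})=H^1(\mathbb{R})$. For $V\in\mathcal{V}$, let $\psi_1$ be the (weakly) increasing and $\psi_2$ the (weakly) decreasing positive solution of $-\psi''+V\psi=0$ on $\mathbb{R}$ satisfying $\lim_{x\to-\infty}(\psi_1(x),x\psi_1'(x))=(1,0)$ and $\lim_{x\to+\infty}(\psi_2(x),x\psi_2'(x))=(1,0)$ (such solutions exist and are linearly independent by classical ODE theory). Set $\psi_V=\psi_1+\psi_2$ and $d\mu_V=\psi_V(x)\,dx$. *)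

theory Defs
  imports "HOL-Analysis.Analysis"
begin

section \<open>Lebesgue spaces on the real line\<close>

text \<open>Elements of \<open>L\<^sup>2\<close> are represented by Borel functions; nothing below distinguishes functions that
  agree almost everywhere.\<close>

definition L2 :: "(real \<Rightarrow> real) set" where
  "L2 = {f. f \<in> borel_measurable lborel \<and> integrable lborel (\<lambda>x. (f x)\<^sup>2)}"

definition l2_inner :: "(real \<Rightarrow> real) \<Rightarrow> (real \<Rightarrow> real) \<Rightarrow> real" where
  "l2_inner f g = (LINT x|lborel. f x * g x)"

definition l2_norm :: "(real \<Rightarrow> real) \<Rightarrow> real" where
  "l2_norm f = sqrt (LINT x|lborel. (f x)\<^sup>2)"

definition l1_norm :: "(real \<Rightarrow> real) \<Rightarrow> real" where
  "l1_norm f = (LINT x|lborel. \<bar>f x\<bar>)"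

section \<open>Operators in \<open>L\<^sup>2\<close>\<close>

text \<open>An operator is given by its graph, saturated under almost-everywhere equality, so its domain
  is \<^const>\<open>Domain\<close> and the product of operators is relational composition.\<close>

type_synonym l2_op = "((real \<Rightarrow> real) \<times> (real \<Rightarrow> real)) set"

definition adjoint_op :: "l2_op \<Rightarrow> l2_op" where
  "adjoint_op T = {(u, v). u \<in> L2 \<and> v \<in> L2 \<and> (\<forall>(f, g) \<in> T. l2_inner g u = l2_inner f v)}"

text \<open>Linearity, and single-valuedness up to almost-everywhere equality, need not be demanded
  separately: an adjoint is a linear relation, and \<open>(0, v) \<in> adjoint_op T\<close> makes \<open>v\<close> orthogonal to
  the dense domain of \<open>T\<close>.\<close>

definition selfadjoint_op :: "l2_op \<Rightarrow> bool" where
  "selfadjoint_op T \<longleftrightarrow>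
     T \<subseteq> L2 \<times> L2 \<and>
     (\<forall>u \<in> L2. \<forall>e > 0. \<exists>f \<in> Domain T. l2_norm (\<lambda>x. u x - f x) < e) \<and>
     adjoint_op T = T"

definition nonneg_op :: "l2_op \<Rightarrow> bool" where
  "nonneg_op T \<longleftrightarrow> (\<forall>(f, g) \<in> T. 0 \<le> l2_inner f g)"

text \<open>\<open>T = S\<^sup>1\<^sup>/\<^sup>2\<close>. For a nonnegative selfadjoint \<open>S\<close> there is exactly one such \<open>T\<close>.\<close>

definition is_sqrt_op :: "l2_op \<Rightarrow> l2_op \<Rightarrow> bool" where
  "is_sqrt_op S T \<longleftrightarrow> selfadjoint_op T \<and> nonneg_op T \<and> T O T = S"

section \<open>The Schroedinger operator\<close>

definition weak_deriv :: "(real \<Rightarrow> real) \<Rightarrow> (real \<Rightarrow> real) \<Rightarrow> bool" where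
  "weak_deriv f g \<longleftrightarrow>
     (\<forall>\<phi>. \<phi> C1_differentiable_on UNIV \<and> compact (closure {x. \<phi> x \<noteq> 0}) \<longrightarrow>
        (LINT x|lborel. f x * deriv \<phi> x) = - (LINT x|lborel. g x * \<phi> x))"

text \<open>The existential conditions below on \<open>f\<close> say that \<open>f\<close> lies in the Sobolev space \<open>H\<^sup>2\<close>;
  \<open>f2\<close> is its second weak derivative.\<close>

definition schroedinger_op :: "(real \<Rightarrow> real) \<Rightarrow> l2_op" where
  "schroedinger_op V =
     {(f, g). f \<in> L2 \<and> g \<in> L2 \<and>
        (\<exists>f1 \<in> L2. \<exists>f2 \<in> L2. weak_deriv f f1 \<and> weak_deriv f1 f2 \<and>
           (AE x in lborel. g x = - f2 x + V x * f x))}"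

definition potentials :: "(real \<Rightarrow> real) set" where
  "potentials =
     {V. continuous_on UNIV V \<and> bounded (range V) \<and> (\<forall>x. 0 \<le> V x) \<and>
         integrable lborel (\<lambda>x. \<bar>x\<bar> * V x) \<and> 0 < (LINT x|lborel. \<bar>x\<bar> * V x)}"

definition zero_energy_solution :: "(real \<Rightarrow> real) \<Rightarrow> (real \<Rightarrow> real) \<Rightarrow> bool" where
  "zero_energy_solution V \<psi> \<longleftrightarrow>
     (\<forall>x. \<psi> differentiable (at x) \<and> deriv \<psi> differentiable (at x) \<and>
          - deriv (deriv \<psi>) x + V x * \<psi> x = 0)"

text \<open>The normalisations at infinity determine \<open>\<psi>\<^sub>1\<close> and \<open>\<psi>\<^sub>2\<close> uniquely.\<close>

definition is_psi1 :: "(real \<Rightarrow> real) \<Rightarrow> (real \<Rightarrow> real) \<Rightarrow> bool" where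
  "is_psi1 V \<psi> \<longleftrightarrow>
     zero_energy_solution V \<psi> \<and> (\<forall>x. 0 < \<psi> x) \<and> mono \<psi> \<and>
     ((\<lambda>x. (\<psi> x, x * deriv \<psi> x)) \<longlongrightarrow> (1, 0)) at_bot"

definition is_psi2 :: "(real \<Rightarrow> real) \<Rightarrow> (real \<Rightarrow> real) \<Rightarrow> bool" where
  "is_psi2 V \<psi> \<longleftrightarrow>
     zero_energy_solution V \<psi> \<and> (\<forall>x. 0 < \<psi> x) \<and> antimono \<psi> \<and>
     ((\<lambda>x. (\<psi> x, x * deriv \<psi> x)) \<longlongrightarrow> (1, 0)) at_top"

definition is_psi_V :: "(real \<Rightarrow> real) \<Rightarrow> (real \<Rightarrow> real) \<Rightarrow> bool" where
  "is_psi_V V \<psi> \<longleftrightarrow>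
     (\<exists>\<psi>1 \<psi>2. is_psi1 V \<psi>1 \<and> is_psi2 V \<psi>2 \<and> \<psi> = (\<lambda>x. \<psi>1 x + \<psi>2 x))"

end

theory Submission
  imports Defs
begin

text \<open>
  The exponents are those of the Nash inequality in dimension three. The reason is that \<open>\<psi>\<close> grows at least
  linearly in both directions, so that the weight makes the line look like a three-dimensional space at infinity.
  The growth follows from convexity (\<open>psi_V_linear_growth\<close>).

  On the other side, finite energy forces \<open>f(x)\<^sup>2 \<le> K (1 + \<bar>x\<bar>) \<parallel>T f\<parallel>\<^sup>2\<close>: the kinetic energy controls the increments
  of \<open>f\<close>, and the potential energy controls \<open>f\<close> somewhere on an interval where \<open>V\<close> is bounded below by a positive constant
  (\<open>pointwise_bound\<close>). Writing \<open>N = \<parallel>f\<parallel>\<^sub>2\<^sup>2\<close>, \<open>M = \<parallel>\<psi> f\<parallel>\<^sub>1\<close> and \<open>G = \<parallel>T f\<parallel>\<^sub>2\<^sup>2\<close>, one splits \<open>\<integral> f\<^sup>2\<close> at \<open>\<bar>x\<bar> = R\<close>. The inner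
  part is at most of order \<open>(1 + R)\<^sup>2 G\<close>, and vanishes for \<open>R = 0\<close>; on the outer part \<open>f\<^sup>2 = \<bar>f\<bar> \<bar>f\<bar>\<close> is at most of order
  \<open>\<psi> \<bar>f\<bar> G\<^sup>1\<^sup>/\<^sup>2 (1 + R)\<^sup>-\<^sup>1\<^sup>/\<^sup>2\<close>. The best \<open>R\<close> gives \<open>N \<le> A M\<^sup>4\<^sup>/\<^sup>5 G\<^sup>3\<^sup>/\<^sup>5\<close>, which is the claim
  (\<open>nash_from_pointwise_bound\<close>).

  It remains to justify the pointwise bound for every \<open>f\<close> in the domain of \<open>T\<close>, a selfadjoint operator known only through
  \<open>T\<^sup>2 = S\<close>. For \<open>w\<close> in the domain of \<open>S\<close>, \<open>\<parallel>T w\<parallel>\<^sup>2 = \<langle>w, S w\<rangle>\<close> is the sum of the kinetic and the potential energy.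
  A general \<open>f\<close> is approximated by \<open>w = k\<^sup>2 (k\<^sup>2 - d\<^sup>2/dx\<^sup>2)\<^sup>-\<^sup>1 f\<close>, which is the convolution of \<open>f\<close> with the
  Laplace kernel. The perturbation \<open>V\<close> is bounded, so \<open>w\<close> lies in the domain of \<open>S\<close>, and the energy of \<open>w\<close>
  exceeds that of \<open>f\<close> by \<open>O(1 / k\<^sup>2)\<close> only (\<open>resolvent_energy_bound\<close>).
\<close>

section \<open>Square-integrable functions\<close>

lemma L2D: "f \<in> L2 \<Longrightarrow> f \<in> borel_measurable borel" "f \<in> L2 \<Longrightarrow> integrable lborel (\<lambda>x. (f x)\<^sup>2)"
  by (auto simp: L2_def)

lemma L2I: "f \<in> borel_measurable borel \<Longrightarrow> integrable lborel (\<lambda>x. (f x)\<^sup>2) \<Longrightarrow> f \<in> L2"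
  by (auto simp: L2_def)

lemma abs_mult_le_sum_squares: "\<bar>a * b\<bar> \<le> a\<^sup>2 + (b::real)\<^sup>2"
proof -
  have "2 * \<bar>a\<bar> * \<bar>b\<bar> \<le> \<bar>a\<bar>\<^sup>2 + \<bar>b\<bar>\<^sup>2" by (rule sum_squares_bound)
  moreover have "0 \<le> \<bar>a\<bar> * \<bar>b\<bar>" by simp
  ultimately show ?thesis by (simp only: abs_mult power2_abs)
qed

lemma integrable_mult_L2:
  assumes "f \<in> L2" "g \<in> L2"
  shows "integrable lborel (\<lambda>x. f x * g x)"
proof (rule Bochner_Integration.integrable_bound)
  show "integrable lborel (\<lambda>x. (f x)\<^sup>2 + (g x)\<^sup>2)" using assms by (auto dest: L2D)
  show "(\<lambda>x. f x * g x) \<in> borel_measurable lborel" using assms[THEN L2D(1)] by measurable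
  show "AE x in lborel. norm (f x * g x) \<le> norm ((f x)\<^sup>2 + (g x)\<^sup>2)"
    by (rule AE_I2) (metis abs_mult_le_sum_squares abs_of_nonneg order.trans real_norm_def abs_ge_zero)
qed

lemma L2_mult_bounded:
  assumes "f \<in> L2" "b \<in> borel_measurable borel" "\<And>x. \<bar>b x\<bar> \<le> c"
  shows "(\<lambda>x. b x * f x) \<in> L2"
proof (rule L2I)
  note [measurable] = assms(2) L2D(1)[OF assms(1)]
  show "(\<lambda>x. b x * f x) \<in> borel_measurable borel" by measurable
  show "integrable lborel (\<lambda>x. (b x * f x)\<^sup>2)"
  proof (rule Bochner_Integration.integrable_bound)
    show "integrable lborel (\<lambda>x. c\<^sup>2 * (f x)\<^sup>2)" using assms by (auto dest: L2D)
    have "(b x)\<^sup>2 \<le> c\<^sup>2" for x using assms(3)[of x] by (metis abs_ge_zero power2_abs power_mono)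
    then show "AE x in lborel. norm ((b x * f x)\<^sup>2) \<le> norm (c\<^sup>2 * (f x)\<^sup>2)"
      by (auto simp: power_mult_distrib intro!: mult_right_mono)
  qed measurable
qed

lemma L2_cmult: "f \<in> L2 \<Longrightarrow> (\<lambda>x. c * f x) \<in> L2"
  by (rule L2_mult_bounded[of f "\<lambda>_. c" "\<bar>c\<bar>"]) auto

lemma L2_add:
  assumes "f \<in> L2" "g \<in> L2"
  shows "(\<lambda>x. f x + g x) \<in> L2"
proof (rule L2I)
  show "(\<lambda>x. f x + g x) \<in> borel_measurable borel" using assms[THEN L2D(1)] by measurable
  have "integrable lborel (\<lambda>x. (f x)\<^sup>2 + (g x)\<^sup>2 + 2 * (f x * g x))"
    using integrable_mult_L2[OF assms] by (intro Bochner_Integration.integrable_add L2D(2) assms integrable_mult_right) auto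
  then show "integrable lborel (\<lambda>x. (f x + g x)\<^sup>2)" by (simp add: power2_sum mult.assoc)
qed

lemma L2_diff: "f \<in> L2 \<Longrightarrow> g \<in> L2 \<Longrightarrow> (\<lambda>x. f x - g x) \<in> L2"
  using L2_add[of f "\<lambda>x. (-1) * g x"] L2_cmult[of g "-1"] by simp

lemma L2_indicator: "indicator {a..b} \<in> L2"
proof (rule L2I)
  have "(\<lambda>x. (indicator {a..b} x)\<^sup>2) = (indicator {a..b} :: real \<Rightarrow> real)"
    by (auto simp: indicator_def)
  moreover have "integrable lborel (indicator {a..b} :: real \<Rightarrow> real)"
    by (rule integrable_real_indicator) (auto simp: emeasure_lborel_Icc_eq)
  ultimately show "integrable lborel (\<lambda>x. (indicator {a..b} x :: real)\<^sup>2)" by simp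
qed measurable

section \<open>The Laplace kernel\<close>

text \<open>The kernel of \<open>k\<^sup>2 (k\<^sup>2 - d\<^sup>2/dx\<^sup>2)\<^sup>-\<^sup>1\<close>, which for \<open>k > 0\<close> is also the density of a probability
  measure; as \<open>k \<rightarrow> \<infinity>\<close> it is an approximate identity.\<close>

definition laplace_kernel :: "real \<Rightarrow> real \<Rightarrow> real" where
  "laplace_kernel k z = k / 2 * exp (- (k * \<bar>z\<bar>))"

lemma laplace_kernel_measurable [measurable]: "laplace_kernel k \<in> borel_measurable borel"
  unfolding laplace_kernel_def by measurable

lemma laplace_kernel_minus_commute: "laplace_kernel k (x - y) = laplace_kernel k (y - x)"
  by (simp add: laplace_kernel_def abs_minus_commute)

lemma laplace_kernel_nonneg: "0 < k \<Longrightarrow> 0 \<le> laplace_kernel k z"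
  by (simp add: laplace_kernel_def)

lemma laplace_kernel_le: "0 < k \<Longrightarrow> laplace_kernel k z \<le> k / 2"
  by (simp add: laplace_kernel_def)

lemma nn_integral_laplace_kernel:
  assumes "0 < k"
  shows "(\<integral>\<^sup>+ z. laplace_kernel k z \<partial>lborel) = 1"
proof -
  let ?P = "laplace_kernel k"
  have "(?P has_integral k / 2 * (exp (- k * 0) / k)) {0..}"
    by (rule has_integral_eq[OF _ has_integral_mult_right[OF has_integral_exp_minus_to_infinity[OF assms, of 0], of "k/2"]])
      (simp add: laplace_kernel_def)
  then have "((\<lambda>z. if z \<in> {0..} then ?P z else 0) has_integral (1 / 2)) UNIV"
    unfolding has_integral_restrict_UNIV using assms by simp
  from nn_integral_has_integral_lborel[OF _ _ this]
  have pos: "(\<integral>\<^sup>+ z. (if z \<in> {0..} then ?P z else 0) \<partial>lborel) = ennreal (1/2)"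
    using assms by (simp add: laplace_kernel_nonneg)
  have neg: "(\<integral>\<^sup>+ z. (if z \<in> {..0} then ?P z else 0) \<partial>lborel) = ennreal (1/2)"
    using nn_integral_real_affine[of "\<lambda>z. ennreal (if z \<in> {..0} then ?P z else 0)" "-1" 0] pos
    by (simp add: laplace_kernel_def cong: if_cong)
  have "(\<integral>\<^sup>+ z. ?P z \<partial>lborel) = (\<integral>\<^sup>+ z. ennreal (if z \<in> {0..} then ?P z else 0) + ennreal (if z \<in> {..0} then ?P z else 0) \<partial>lborel)"
    by (rule nn_integral_cong_AE, rule AE_mp[OF AE_lborel_singleton[of 0]]) (auto intro!: AE_I2)
  also have "\<dots> = ennreal (1/2) + ennreal (1/2)"
    using pos neg by (subst nn_integral_add) auto
  also have "\<dots> = ennreal (1/2 + 1/2)" by (rule ennreal_plus[symmetric]) auto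
  finally show ?thesis by simp
qed

lemma integrable_laplace_kernel: "0 < k \<Longrightarrow> integrable lborel (laplace_kernel k)"
  by (rule integrableI_nn_integral_finite[where x=1]) (auto simp: laplace_kernel_nonneg nn_integral_laplace_kernel)

lemma integral_laplace_kernel: "0 < k \<Longrightarrow> (LINT z|lborel. laplace_kernel k z) = 1"
  by (subst integral_eq_nn_integral) (auto simp: laplace_kernel_nonneg nn_integral_laplace_kernel)

lemma
  assumes "0 < k"
  shows integrable_laplace_kernel_shift: "integrable lborel (\<lambda>y. laplace_kernel k (x - y))"
    and integral_laplace_kernel_shift: "(LINT y|lborel. laplace_kernel k (x - y)) = 1"
  using lborel_integrable_real_affine[OF integrable_laplace_kernel[OF assms], of "-1" x]
    lborel_integral_real_affine[of "-1" "laplace_kernel k" x] integral_laplace_kernel[OF assms] by auto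

lemma laplace_kernel_L2:
  assumes "0 < k"
  shows "(\<lambda>y. laplace_kernel k (x - y)) \<in> L2"
proof (rule L2I)
  show "integrable lborel (\<lambda>y. (laplace_kernel k (x - y))\<^sup>2)"
  proof (rule Bochner_Integration.integrable_bound)
    show "integrable lborel (\<lambda>y. k / 2 * laplace_kernel k (x - y))"
      using integrable_laplace_kernel_shift[OF assms] by auto
    show "AE y in lborel. norm ((laplace_kernel k (x - y))\<^sup>2) \<le> norm (k / 2 * laplace_kernel k (x - y))"
      using assms mult_right_mono[OF laplace_kernel_le[OF assms] laplace_kernel_nonneg[OF assms]]
      by (intro AE_I2) (simp add: power2_eq_square abs_mult laplace_kernel_nonneg)
  qed measurable
qed measurable

lemma integrable_laplace_kernel_mult:
  assumes "0 < k" "integrable lborel h"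
  shows "integrable lborel (\<lambda>y. laplace_kernel k (x - y) * h y)"
proof (rule Bochner_Integration.integrable_bound)
  have [measurable]: "h \<in> borel_measurable borel" using assms(2) by auto
  show "integrable lborel (\<lambda>y. k / 2 * h y)" using assms by auto
  show "AE y in lborel. norm (laplace_kernel k (x - y) * h y) \<le> norm (k / 2 * h y)"
    using assms(1) mult_right_mono[OF laplace_kernel_le[OF assms(1)] abs_ge_zero]
    by (intro AE_I2) (simp add: abs_mult laplace_kernel_nonneg)
qed (use assms(2) in measurable)

lemma integrable_pair_laplace_kernel:
  assumes "0 < k" "integrable lborel h"
  shows "integrable (lborel \<Otimes>\<^sub>M lborel) (\<lambda>(x, y). laplace_kernel k (x - y) * h y)"
    and "integrable (lborel \<Otimes>\<^sub>M lborel) (\<lambda>(x, y). laplace_kernel k (x - y) * h x)"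
proof -
  note [measurable] = borel_measurable_integrable[OF assms(2)]
  have *: "integrable (lborel \<Otimes>\<^sub>M lborel) (\<lambda>(x, y). laplace_kernel k (x - y) * h x)"
  proof (rule lborel_pair.Fubini_integrable)
    have "(\<lambda>x. LINT y|lborel. norm (case (x, y) of (x, y) \<Rightarrow> laplace_kernel k (x - y) * h x)) = (\<lambda>x. \<bar>h x\<bar>)"
      using integral_laplace_kernel_shift[OF assms(1)] laplace_kernel_nonneg[OF assms(1)]
      by (simp add: abs_mult)
    then show "integrable lborel (\<lambda>x. LINT y|lborel. norm (case (x, y) of (x, y) \<Rightarrow> laplace_kernel k (x - y) * h x))"
      using assms(2) by simp
    show "AE x in lborel. integrable lborel (\<lambda>y. case (x, y) of (x, y) \<Rightarrow> laplace_kernel k (x - y) * h x)"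
      using integrable_laplace_kernel_shift[OF assms(1)] by simp
  qed measurable
  show "integrable (lborel \<Otimes>\<^sub>M lborel) (\<lambda>(x, y). laplace_kernel k (x - y) * h x)" by fact
  show "integrable (lborel \<Otimes>\<^sub>M lborel) (\<lambda>(x, y). laplace_kernel k (x - y) * h y)"
    using lborel_pair.integrable_product_swap[OF *]
    by (simp add: laplace_kernel_minus_commute case_prod_unfold)
qed

section \<open>Convolution with a dominated kernel\<close>

text \<open>To be applied to the Laplace kernel and to its derivative divided by \<open>k\<close>. Domination by the Laplace
  kernel, a probability density, makes convolution a contraction of \<open>L\<^sup>2\<close> and justifies the exchange of
  integrals.\<close>

definition conv :: "(real \<Rightarrow> real) \<Rightarrow> (real \<Rightarrow> real) \<Rightarrow> real \<Rightarrow> real" where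
  "conv H f x = (LINT y|lborel. H (x - y) * f y)"

context
  fixes k :: real and H :: "real \<Rightarrow> real" and f :: "real \<Rightarrow> real"
  assumes k: "0 < k" and H[measurable]: "H \<in> borel_measurable borel"
    and dom: "\<And>z. \<bar>H z\<bar> \<le> laplace_kernel k z" and f: "f \<in> L2"
begin

lemma integrable_conv: "integrable lborel (\<lambda>y. H (x - y) * f y)"
proof (rule Bochner_Integration.integrable_bound)
  note [measurable] = L2D(1)[OF f]
  show "(\<lambda>y. H (x - y) * f y) \<in> borel_measurable lborel" by measurable
  show "integrable lborel (\<lambda>y. laplace_kernel k (x - y) * f y)"
    by (rule integrable_mult_L2[OF laplace_kernel_L2[OF k] f])
  show "AE y in lborel. norm (H (x - y) * f y) \<le> norm (laplace_kernel k (x - y) * f y)"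
    using dom by (auto simp: abs_mult laplace_kernel_nonneg[OF k] intro!: mult_right_mono)
qed

lemma conv_measurable: "conv H f \<in> borel_measurable borel"
proof -
  note [measurable] = L2D(1)[OF f]
  have "(\<lambda>x. LINT y|lborel. H (x - y) * f y) \<in> borel_measurable lborel"
    by (rule lborel.borel_measurable_lebesgue_integral) measurable
  then show ?thesis by (simp add: conv_def[abs_def])
qed

text \<open>Jensen's inequality for the probability density \<open>laplace_kernel k (x - y)\<close> in \<open>y\<close>, obtained from the
  nonnegativity of the variance of \<open>\<bar>f\<bar>\<close>.\<close>

lemma conv_square_le: "(conv H f x)\<^sup>2 \<le> (LINT y|lborel. laplace_kernel k (x - y) * (f y)\<^sup>2)"
proof -
  let ?P = "\<lambda>y. laplace_kernel k (x - y)"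
  have Pf: "integrable lborel (\<lambda>y. ?P y * \<bar>f y\<bar>)"
    using integrable_abs[OF integrable_mult_L2[OF laplace_kernel_L2[OF k] f, of x]]
    by (simp add: abs_mult laplace_kernel_nonneg[OF k])
  define m where "m = (LINT y|lborel. ?P y * \<bar>f y\<bar>)"
  have Pf2: "integrable lborel (\<lambda>y. ?P y * (f y)\<^sup>2)"
    by (rule integrable_laplace_kernel_mult[OF k L2D(2)[OF f]])
  have P: "integrable lborel ?P" by (rule integrable_laplace_kernel_shift[OF k])
  have "\<bar>conv H f x\<bar> \<le> (LINT y|lborel. \<bar>H (x - y) * f y\<bar>)"
    unfolding conv_def by (rule integral_abs_bound)
  also have "\<dots> \<le> m"
    unfolding m_def using Pf integrable_abs[OF integrable_conv[of x]]
    by (intro integral_mono) (auto simp: abs_mult dom intro!: mult_right_mono)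
  finally have le: "\<bar>conv H f x\<bar> \<le> m" .
  have "0 \<le> (LINT y|lborel. ?P y * (\<bar>f y\<bar> - m)\<^sup>2)"
    by (rule integral_nonneg_AE) (simp add: laplace_kernel_nonneg[OF k])
  also have "(\<lambda>y. ?P y * (\<bar>f y\<bar> - m)\<^sup>2) = (\<lambda>y. ?P y * (f y)\<^sup>2 + (- 2 * m) * (?P y * \<bar>f y\<bar>) + m\<^sup>2 * ?P y)"
    by (simp add: power2_diff algebra_simps)
  also have "(LINT y|lborel. ?P y * (f y)\<^sup>2 + (- 2 * m) * (?P y * \<bar>f y\<bar>) + m\<^sup>2 * ?P y)
     = (LINT y|lborel. ?P y * (f y)\<^sup>2) + (- 2 * m) * m + m\<^sup>2 * 1"
    using Pf Pf2 P unfolding m_def by (simp add: integral_laplace_kernel_shift[OF k])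
  finally have "m\<^sup>2 \<le> (LINT y|lborel. ?P y * (f y)\<^sup>2)" by (simp add: power2_eq_square)
  moreover have "(conv H f x)\<^sup>2 \<le> m\<^sup>2" using le by (metis abs_ge_zero power2_abs power_mono)
  ultimately show ?thesis by linarith
qed

lemma conv_L2: "conv H f \<in> L2" 
  and conv_norm_le: "(LINT x|lborel. (conv H f x)\<^sup>2) \<le> (LINT x|lborel. (f x)\<^sup>2)"
proof -
  note [measurable] = conv_measurable
  note J = integrable_pair_laplace_kernel(1)[OF k L2D(2)[OF f]]
  have I: "integrable lborel (\<lambda>x. LINT y|lborel. laplace_kernel k (x - y) * (f y)\<^sup>2)"
    by (rule lborel_pair.integrable_fst[OF J])
  have sq: "integrable lborel (\<lambda>x. (conv H f x)\<^sup>2)"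
    by (rule Bochner_Integration.integrable_bound[OF I])
      (use conv_square_le in \<open>auto intro: order.trans[OF _ abs_ge_self]\<close>)
  then show "conv H f \<in> L2" by (intro L2I conv_measurable)
  have "(LINT x|lborel. (conv H f x)\<^sup>2) \<le> (LINT x|lborel. LINT y|lborel. laplace_kernel k (x - y) * (f y)\<^sup>2)"
    using sq I conv_square_le by (rule integral_mono)
  also have "\<dots> = (LINT y|lborel. LINT x|lborel. laplace_kernel k (x - y) * (f y)\<^sup>2)"
    by (rule lborel_pair.Fubini_integral[OF J, symmetric])
  also have "\<dots> = (LINT y|lborel. (f y)\<^sup>2)"
    by (simp add: integral_laplace_kernel_shift[OF k] laplace_kernel_minus_commute[of k _ "_::real"])
  finally show "(LINT x|lborel. (conv H f x)\<^sup>2) \<le> (LINT x|lborel. (f x)\<^sup>2)" .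
qed

lemma integral_mult_conv:
  assumes a: "a \<in> L2"
  shows "(LINT x|lborel. a x * conv H f x) = (LINT y|lborel. (LINT x|lborel. a x * H (x - y)) * f y)"
proof -
  note [measurable] = L2D(1)[OF a] L2D(1)[OF f]
  have J: "integrable (lborel \<Otimes>\<^sub>M lborel) (\<lambda>(x, y). a x * H (x - y) * f y)"
  proof (rule Bochner_Integration.integrable_bound)
    show "integrable (lborel \<Otimes>\<^sub>M lborel) (\<lambda>p. (case p of (x, y) \<Rightarrow> laplace_kernel k (x - y) * (a x)\<^sup>2)
       + (case p of (x, y) \<Rightarrow> laplace_kernel k (x - y) * (f y)\<^sup>2))"
      by (intro Bochner_Integration.integrable_add integrable_pair_laplace_kernel[OF k] L2D(2) a f)
    have "\<bar>a x * H (x - y) * f y\<bar> \<le> laplace_kernel k (x - y) * (a x)\<^sup>2 + laplace_kernel k (x - y) * (f y)\<^sup>2" for x y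
    proof -
      have "\<bar>a x * H (x - y) * f y\<bar> = \<bar>H (x - y)\<bar> * \<bar>a x * f y\<bar>" by (simp add: abs_mult)
      also have "\<dots> \<le> laplace_kernel k (x - y) * ((a x)\<^sup>2 + (f y)\<^sup>2)"
        using dom laplace_kernel_nonneg[OF k] by (intro mult_mono abs_mult_le_sum_squares) auto
      finally show ?thesis by (simp add: algebra_simps)
    qed
    then show "AE p in lborel \<Otimes>\<^sub>M lborel. norm (case p of (x, y) \<Rightarrow> a x * H (x - y) * f y)
      \<le> norm ((case p of (x, y) \<Rightarrow> laplace_kernel k (x - y) * (a x)\<^sup>2) + (case p of (x, y) \<Rightarrow> laplace_kernel k (x - y) * (f y)\<^sup>2))"
      by (intro AE_I2) (auto intro: order.trans[OF _ abs_ge_self])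
  qed measurable
  have "(LINT x|lborel. a x * conv H f x) = (LINT x|lborel. LINT y|lborel. a x * H (x - y) * f y)"
    by (simp add: conv_def mult.assoc)
  also have "\<dots> = (LINT y|lborel. LINT x|lborel. a x * H (x - y) * f y)"
    by (rule lborel_pair.Fubini_integral[OF J, symmetric])
  finally show ?thesis by simp
qed

text \<open>A jump of \<open>H\<close> at the origin does no harm: dominated convergence only sees the kernel at \<open>y \<noteq> x\<close>.\<close>

lemma continuous_conv:
  assumes cont: "\<And>z. z \<noteq> 0 \<Longrightarrow> isCont H z"
  shows "continuous_on UNIV (conv H f)"
  unfolding continuous_on_sequentially
proof (intro allI ballI impI)
  note [measurable] = L2D(1)[OF f]
  fix u :: "nat \<Rightarrow> real" and x assume "(\<forall>n. u n \<in> UNIV) \<and> u \<longlonglongrightarrow> x"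
  then have u: "u \<longlonglongrightarrow> x" by blast
  \<comment> \<open>A uniform bound on the shifts makes all the shifted kernels comparable to the one at \<open>x\<close>.\<close>
  then obtain B where B: "\<And>n. \<bar>u n - x\<bar> \<le> B"
    using convergent_imp_Bseq[of "\<lambda>n. u n - x"] convergent_diff[of u "\<lambda>_. x"]
    by (auto simp: Bseq_def convergent_def convergent_const)
  have "(\<lambda>n. LINT y|lborel. H (u n - y) * f y) \<longlonglongrightarrow> (LINT y|lborel. H (x - y) * f y)"
  proof (rule integral_dominated_convergence)
    show "integrable lborel (\<lambda>y. exp (k * B) * \<bar>laplace_kernel k (x - y) * f y\<bar>)"
      using integrable_mult_L2[OF laplace_kernel_L2[OF k] f] by auto
    show "AE y in lborel. (\<lambda>n. H (u n - y) * f y) \<longlonglongrightarrow> H (x - y) * f y"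
    proof (rule AE_mp[OF AE_lborel_singleton[of x]], intro AE_I2 impI)
      fix y assume "y \<noteq> x"
      then have "isCont H (x - y)" by (intro cont) auto
      then show "(\<lambda>n. H (u n - y) * f y) \<longlonglongrightarrow> H (x - y) * f y"
        by (intro tendsto_intros isCont_tendsto_compose[where g=H] u)
    qed
    have "laplace_kernel k (u n - y) \<le> exp (k * B) * laplace_kernel k (x - y)" for n y
    proof -
      have "\<bar>x - y\<bar> \<le> B + \<bar>u n - y\<bar>" using B[of n] by linarith
      then have "k * \<bar>x - y\<bar> \<le> k * B + k * \<bar>u n - y\<bar>" using k by (metis distrib_left mult_left_mono less_imp_le)
      then have "exp (- (k * \<bar>u n - y\<bar>)) \<le> exp (k * B + - (k * \<bar>x - y\<bar>))" by simp
      then have "k / 2 * exp (- (k * \<bar>u n - y\<bar>)) \<le> k / 2 * (exp (k * B) * exp (- (k * \<bar>x - y\<bar>)))"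
        unfolding exp_add using k by (intro mult_left_mono) auto
      then show ?thesis by (simp add: laplace_kernel_def mult_ac)
    qed
    then show "AE y in lborel. norm (H (u n - y) * f y) \<le> exp (k * B) * \<bar>laplace_kernel k (x - y) * f y\<bar>" for n
      using laplace_kernel_nonneg[OF k]
      by (intro AE_I2) (auto simp: abs_mult mult.assoc[symmetric] intro!: mult_right_mono intro: order.trans[OF dom])
  qed measurable
  then show "(conv H f \<circ> u) \<longlonglongrightarrow> conv H f x" by (simp add: conv_def o_def)
qed

end

section \<open>Test functions and integration by parts\<close>

lemma continuous_compact_support_L2:
  fixes u :: "real \<Rightarrow> real"
  assumes "continuous_on UNIV u" and supp: "\<And>x. u x \<noteq> 0 \<Longrightarrow> \<bar>x\<bar> < M"
  shows "u \<in> L2" "integrable lborel u"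
proof -
  have *: "integrable lborel v" if "continuous_on UNIV v" "\<And>x. v x \<noteq> 0 \<Longrightarrow> u x \<noteq> 0" for v :: "real \<Rightarrow> real"
  proof -
    have "integrable lborel (\<lambda>x. indicator {-M..M} x *\<^sub>R v x)"
      using that(1) by (intro borel_integrable_compact) (auto intro: continuous_on_subset)
    moreover have "(\<lambda>x. indicator {-M..M} x *\<^sub>R v x) = v"
      using that(2) supp by (fastforce simp: indicator_def)
    ultimately show ?thesis by simp
  qed
  show "integrable lborel u" using * assms(1) by auto
  have "u \<in> borel_measurable borel" using assms(1) by (rule borel_measurable_continuous_onI)
  moreover have "integrable lborel (\<lambda>x. (u x)\<^sup>2)" using assms(1) by (intro *) (auto intro!: continuous_intros)
  ultimately show "u \<in> L2" by (rule L2I)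
qed

text \<open>The primitives below have a corner: convolution kernels are smooth only off the diagonal.\<close>

lemma integral_FTC_except:
  fixes u u' :: "real \<Rightarrow> real"
  assumes "finite S" "a \<le> b" "continuous_on {a..b} u"
    and "\<And>x. x \<in> {a<..<b} - S \<Longrightarrow> (u has_real_derivative u' x) (at x)"
    and "integrable lborel (\<lambda>x. indicator {a..b} x * u' x)"
  shows "(LINT x|lborel. indicator {a..b} x * u' x) = u b - u a"
proof -
  have "(u' has_integral (u b - u a)) {a..b}"
    using assms(1-4) by (intro fundamental_theorem_of_calculus_interior_strong)
      (auto simp: has_real_derivative_iff_has_vector_derivative)
  moreover have "set_integrable lborel {a..b} u'" using assms(5) by (simp add: set_integrable_def)
  ultimately show ?thesis
    using set_borel_integral_eq_integral(2)[of "{a..b}" u']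
    by (simp add: set_lebesgue_integral_def integral_unique)
qed

lemma test_functionE:
  assumes "\<phi> C1_differentiable_on UNIV" "compact (closure {x. \<phi> x \<noteq> (0::real)})"
  obtains M where "\<And>x. (\<phi> has_real_derivative deriv \<phi> x) (at x)" "continuous_on UNIV (deriv \<phi>)"
    "continuous_on UNIV \<phi>" "\<And>x. \<phi> x \<noteq> 0 \<Longrightarrow> \<bar>x\<bar> < M" "\<And>x. deriv \<phi> x \<noteq> 0 \<Longrightarrow> \<bar>x\<bar> < M"
proof -
  obtain D where D: "\<And>x. (\<phi> has_real_derivative D x) (at x)" "continuous_on UNIV D"
    using assms(1) by (auto simp: C1_differentiable_on_def has_real_derivative_iff_has_vector_derivative)
  have [simp]: "deriv \<phi> = D" using D(1) by (auto intro: DERIV_imp_deriv)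
  have "bounded {x. \<phi> x \<noteq> 0}" using assms(2) by (meson bounded_subset closure_subset compact_imp_bounded)
  then obtain B where B: "\<And>x. \<phi> x \<noteq> 0 \<Longrightarrow> \<bar>x\<bar> \<le> B" by (auto simp: bounded_iff)
  have "D x = 0" if "B < \<bar>x\<bar>" for x
  proof -
    have op: "open {x::real. B < \<bar>x\<bar>}" by (intro open_Collect_less continuous_intros)
    have zero: "\<phi> y = 0" if "y \<in> {x. B < \<bar>x\<bar>}" for y using B[of y] that by force
    have "(\<phi> has_real_derivative 0) (at x)"
      by (rule has_field_derivative_transform_within_open[where f="\<lambda>_. 0" and S="{x. B < \<bar>x\<bar>}"])
        (use that op zero in auto)
    then show ?thesis using D(1) DERIV_unique by blast
  qed
  then have D0: "\<bar>x\<bar> < B + 1" if "D x \<noteq> 0" for x using that by (meson le_less_trans less_add_one not_le)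
  have B0: "\<bar>x\<bar> < B + 1" if "\<phi> x \<noteq> 0" for x using B[OF that] by linarith
  have "continuous_on UNIV \<phi>" using D(1) by (auto intro: DERIV_continuous_on)
  then show ?thesis
    by (intro that[of "B + 1"]) (simp_all add: D B0 D0)
qed

lemma weak_deriv_C1:
  assumes d: "\<And>x. (w has_real_derivative w1 x) (at x)" and c: "continuous_on UNIV w1"
  shows "weak_deriv w w1"
  unfolding weak_deriv_def
proof (intro allI impI, elim conjE)
  fix \<phi> :: "real \<Rightarrow> real"
  assume "\<phi> C1_differentiable_on UNIV" "compact (closure {x. \<phi> x \<noteq> 0})"
  then obtain M where \<phi>: "\<And>x. (\<phi> has_real_derivative deriv \<phi> x) (at x)" "continuous_on UNIV (deriv \<phi>)"
    "continuous_on UNIV \<phi>" "\<And>x. \<phi> x \<noteq> 0 \<Longrightarrow> \<bar>x\<bar> < M" "\<And>x. deriv \<phi> x \<noteq> 0 \<Longrightarrow> \<bar>x\<bar> < M"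
    by (rule test_functionE) blast
  have w: "continuous_on UNIV w" using d by (auto intro: DERIV_continuous_on)
  have i1: "integrable lborel (\<lambda>x. w x * deriv \<phi> x)"
    by (rule continuous_compact_support_L2(2)[of _ M]) (use w \<phi> in \<open>auto intro!: continuous_intros\<close>)
  have i2: "integrable lborel (\<lambda>x. w1 x * \<phi> x)"
    by (rule continuous_compact_support_L2(2)[of _ M]) (use c \<phi> in \<open>auto intro!: continuous_intros\<close>)
  define L where "L = \<bar>M\<bar> + 1"
  have L: "(\<lambda>x. indicator {-L..L} x * (w x * deriv \<phi> x + w1 x * \<phi> x)) = (\<lambda>x. w x * deriv \<phi> x + w1 x * \<phi> x)"
  proof
    fix x
    show "indicator {-L..L} x * (w x * deriv \<phi> x + w1 x * \<phi> x) = w x * deriv \<phi> x + w1 x * \<phi> x"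
    proof (cases "x \<in> {-L..L}")
      case False
      then have "\<phi> x = 0" "deriv \<phi> x = 0" using \<phi>(4,5)[of x] by (fastforce simp: L_def)+
      then show ?thesis by simp
    qed simp
  qed
  have "(LINT x|lborel. indicator {-L..L} x * (w x * deriv \<phi> x + w1 x * \<phi> x)) = w L * \<phi> L - w (-L) * \<phi> (-L)"
  proof (rule integral_FTC_except[of "{}"])
    show "continuous_on {-L..L} (\<lambda>x. w x * \<phi> x)"
      by (intro continuous_intros continuous_on_subset[OF w] continuous_on_subset[OF \<phi>(3)]) auto
    show "((\<lambda>x. w x * \<phi> x) has_real_derivative w x * deriv \<phi> x + w1 x * \<phi> x) (at x)" for x
      using DERIV_mult[OF d \<phi>(1), of x] by (simp add: mult.commute add.commute)
  qed (use L i1 i2 in \<open>auto simp: L_def\<close>)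
  moreover have "\<phi> L = 0" "\<phi> (-L) = 0" using \<phi>(4)[of L] \<phi>(4)[of "-L"] by (fastforce simp: L_def)+
  ultimately have "(LINT x|lborel. w x * deriv \<phi> x + w1 x * \<phi> x) = 0" unfolding L by simp
  then show "(LINT x|lborel. w x * deriv \<phi> x) = - (LINT x|lborel. w1 x * \<phi> x)"
    using i1 i2 by simp
qed

section \<open>Cutoff functions\<close>

text \<open>An explicit \<open>C\<^sup>1\<close> bump supported in \<open>[-R, R]\<close>, with slope of order \<open>1 / R\<close>: a
  truncated parabola, squared so that the derivative vanishes continuously at the edge.\<close>

definition cutoff :: "real \<Rightarrow> real \<Rightarrow> real" where
  "cutoff R x = (max 0 (1 - (x / R)\<^sup>2))\<^sup>2"

definition cutoff' :: "real \<Rightarrow> real \<Rightarrow> real" where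
  "cutoff' R x = - 4 * x / R\<^sup>2 * max 0 (1 - (x / R)\<^sup>2)"

lemma DERIV_positive_part_square: "((\<lambda>u::real. (max 0 u)\<^sup>2) has_real_derivative 2 * max 0 u) (at u)"
proof -
  consider "u < 0" | "0 < u" | "u = 0" by linarith
  then show ?thesis
  proof cases
    case 1
    have "((\<lambda>u::real. (max 0 u)\<^sup>2) has_real_derivative 0) (at u)"
      by (rule has_field_derivative_transform_within_open[where f="\<lambda>_. 0" and S="{..<0}"]) (use 1 in auto)
    then show ?thesis using 1 by simp
  next
    case 2
    have "((\<lambda>u::real. (max 0 u)\<^sup>2) has_real_derivative 2 * u) (at u)"
      by (rule has_field_derivative_transform_within_open[where f="\<lambda>u. u\<^sup>2" and S="{0<..}"])
        (use 2 in \<open>auto intro!: derivative_eq_intros\<close>)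
    then show ?thesis using 2 by simp
  next
    case 3
    have "((\<lambda>h::real. max 0 h) \<longlongrightarrow> max 0 0) (at 0)" by (intro tendsto_intros)
    then have "((\<lambda>h::real. max 0 h) \<longlongrightarrow> 0) (at 0)" by simp
    moreover have "\<forall>\<^sub>F h::real in at 0. max 0 h = ((max 0 (0 + h))\<^sup>2 - (max 0 0)\<^sup>2) / h"
      by (auto simp: eventually_at power2_eq_square max_def intro!: exI[of _ 1])
    ultimately have "((\<lambda>h::real. ((max 0 (0 + h))\<^sup>2 - (max 0 0)\<^sup>2) / h) \<longlongrightarrow> 0) (at 0)"
      by (rule Lim_transform_eventually)
    then show ?thesis using 3 by (simp add: DERIV_def)
  qed
qed

lemma DERIV_cutoff:
  assumes "R \<noteq> 0"
  shows "(cutoff R has_real_derivative cutoff' R x) (at x)"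
proof -
  have "((\<lambda>x. 1 - (x / R)\<^sup>2) has_real_derivative - (2 * (x / R) * (1 / R))) (at x)"
    using assms by (auto intro!: derivative_eq_intros)
  from DERIV_chain2[OF DERIV_positive_part_square this]
  have "(cutoff R has_real_derivative 2 * max 0 (1 - (x / R)\<^sup>2) * - (2 * (x / R) * (1 / R))) (at x)"
    by (simp add: cutoff_def[abs_def])
  also have "2 * max 0 (1 - (x / R)\<^sup>2) * - (2 * (x / R) * (1 / R)) = cutoff' R x"
    by (simp add: cutoff'_def power2_eq_square)
  finally show ?thesis .
qed

lemma continuous_cutoff': "continuous_on UNIV (cutoff' R)"
  unfolding cutoff'_def[abs_def] by (cases "R = 0") (auto intro!: continuous_intros)

lemma cutoff_support: 
  assumes "0 < R" "cutoff R x \<noteq> 0"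
  shows "\<bar>x\<bar> < R"
proof -
  have "(x / R)\<^sup>2 < 1" using assms(2) by (auto simp: cutoff_def max_def split: if_splits)
  then have "\<bar>x / R\<bar> < 1" by (simp only: abs_square_less_1)
  then show ?thesis using assms(1) by simp
qed

lemma cutoff_bounds: "\<bar>cutoff R x\<bar> \<le> 1"
  by (simp add: cutoff_def abs_square_le_1)

lemma cutoff'_bound:
  assumes "1 \<le> R"
  shows "\<bar>cutoff' R x\<bar> \<le> 4 / R"
proof (cases "\<bar>x\<bar> \<le> R")
  case True
  have "\<bar>cutoff' R x\<bar> = 4 / R * (\<bar>x\<bar> / R * max 0 (1 - (x / R)\<^sup>2))"
    using assms by (simp add: cutoff'_def abs_mult power2_eq_square)
  also have "\<dots> \<le> 4 / R * (1 * 1)"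
    using True assms by (intro mult_left_mono mult_mono) auto
  finally show ?thesis by simp
next
  case False
  then have "1 < (x / R)\<^sup>2" using assms by (simp add: one_less_power abs_square_less_1 not_le[symmetric] abs_square_le_1)
  then show ?thesis using assms by (simp add: cutoff'_def)
qed

text \<open>Integration by parts on the whole line. As \<open>w1\<close> has only a weak derivative, \<open>w\<close> itself times a
  cutoff serves as the test function; the term with the derivative of the cutoff disappears in the limit because
  \<open>w w1\<close> is integrable.\<close>

lemma energy_identity:
  assumes d: "\<And>x. (w has_real_derivative w1 x) (at x)" and c: "continuous_on UNIV w1"
    and L: "w \<in> L2" "w1 \<in> L2" "w2 \<in> L2" and wd: "weak_deriv w1 w2"
  shows "(LINT x|lborel. w x * w2 x) = - (LINT x|lborel. (w1 x)\<^sup>2)"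
proof -
  note [measurable] = L[THEN L2D(1)]
  have w: "continuous_on UNIV w" using d by (auto intro: DERIV_continuous_on)
  define R where "R n = real n + 1" for n :: nat
  have R: "1 \<le> R n" for n by (simp add: R_def)
  have Rinf: "filterlim R at_top sequentially"
    unfolding R_def[abs_def] by (intro filterlim_tendsto_add_at_top[of _ 1, OF tendsto_const, simplified add.commute[of 1]] filterlim_real_sequentially)
  have cm[measurable]: "cutoff r \<in> borel_measurable borel" "cutoff' r \<in> borel_measurable borel" for r
    by (auto simp: cutoff_def[abs_def] cutoff'_def[abs_def])
  have lim: "(\<lambda>n. x / R n) \<longlonglongrightarrow> 0" for x :: real
    by (intro tendsto_divide_0[OF tendsto_const] filterlim_at_top_imp_at_infinity Rinf)
  have lim1: "(\<lambda>n. cutoff (R n) x) \<longlonglongrightarrow> 1" for x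
  proof -
    have "(\<lambda>n. (max 0 (1 - (x / R n)\<^sup>2))\<^sup>2) \<longlonglongrightarrow> (max 0 (1 - 0\<^sup>2))\<^sup>2"
      by (intro tendsto_intros lim)
    then show ?thesis by (simp add: cutoff_def)
  qed
  have lim2: "(\<lambda>n. cutoff' (R n) x) \<longlonglongrightarrow> 0" for x
    by (rule tendsto_rabs_zero_cancel, rule tendsto_sandwich[OF _ _ tendsto_const lim[of 4]])
      (use cutoff'_bound[OF R] in auto)
  have eq: "(LINT x|lborel. w1 x * (w1 x * cutoff (R n) x + w x * cutoff' (R n) x)) = - (LINT x|lborel. w2 x * (w x * cutoff (R n) x))" for n
  proof -
    let ?\<phi> = "\<lambda>x. w x * cutoff (R n) x" and ?\<phi>' = "\<lambda>x. w1 x * cutoff (R n) x + w x * cutoff' (R n) x"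
    have dc: "(cutoff (R n) has_real_derivative cutoff' (R n) x) (at x)" for x
      using R[of n] by (intro DERIV_cutoff) auto
    have D: "(?\<phi> has_real_derivative ?\<phi>' x) (at x)" for x
      using DERIV_mult[OF d dc, of x] by (simp add: mult.commute add.commute)
    have "continuous_on UNIV (cutoff (R n))" using dc by (auto intro: DERIV_continuous_on)
    then have "continuous_on UNIV ?\<phi>'" using w c continuous_cutoff' by (intro continuous_intros) auto
    then have "?\<phi> C1_differentiable_on UNIV"
      using D unfolding C1_differentiable_on_def has_real_derivative_iff_has_vector_derivative[symmetric]
      by (intro exI[of _ ?\<phi>'] conjI ballI) auto
    moreover have "compact (closure {x. ?\<phi> x \<noteq> 0})"
    proof -
      have "{x. ?\<phi> x \<noteq> 0} \<subseteq> {-R n..R n}" using cutoff_support[of "R n"] R[of n] by fastforce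
      then show ?thesis by (meson bounded_closed_interval bounded_subset compact_closure)
    qed
    moreover have "deriv ?\<phi> = ?\<phi>'" using D by (auto intro!: ext DERIV_imp_deriv)
    ultimately show ?thesis using wd unfolding weak_deriv_def by metis
  qed
  have "(\<lambda>n. LINT x|lborel. w1 x * (w1 x * cutoff (R n) x + w x * cutoff' (R n) x)) \<longlonglongrightarrow> (LINT x|lborel. w1 x * (w1 x * 1 + w x * 0))"
  proof (rule integral_dominated_convergence)
    show "integrable lborel (\<lambda>x. \<bar>w1 x * w1 x\<bar> + 4 * \<bar>w1 x * w x\<bar>)"
      using integrable_mult_L2[OF L(2) L(2)] integrable_mult_L2[OF L(2) L(1)] by auto
    show "AE x in lborel. norm (w1 x * (w1 x * cutoff (R n) x + w x * cutoff' (R n) x)) \<le> \<bar>w1 x * w1 x\<bar> + 4 * \<bar>w1 x * w x\<bar>" for n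
    proof (rule AE_I2)
      fix x
      have "4 / R n \<le> 4" using R[of n] by (simp add: field_simps)
      then have "\<bar>cutoff' (R n) x\<bar> \<le> 4" using cutoff'_bound[OF R[of n], of x] by linarith
      then have "\<bar>w1 x * w x\<bar> * \<bar>cutoff' (R n) x\<bar> \<le> \<bar>w1 x * w x\<bar> * 4" by (intro mult_left_mono) auto
      moreover have "\<bar>w1 x * w1 x\<bar> * \<bar>cutoff (R n) x\<bar> \<le> \<bar>w1 x * w1 x\<bar> * 1" using cutoff_bounds by (intro mult_left_mono) auto
      moreover have "w1 x * (w1 x * cutoff (R n) x + w x * cutoff' (R n) x) = (w1 x * w1 x) * cutoff (R n) x + (w1 x * w x) * cutoff' (R n) x"
        by (simp add: algebra_simps)
      ultimately show "norm (w1 x * (w1 x * cutoff (R n) x + w x * cutoff' (R n) x)) \<le> \<bar>w1 x * w1 x\<bar> + 4 * \<bar>w1 x * w x\<bar>"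
        using abs_triangle_ineq[of "(w1 x * w1 x) * cutoff (R n) x" "(w1 x * w x) * cutoff' (R n) x"]
        by (simp add: abs_mult)
    qed
    show "AE x in lborel. (\<lambda>n. w1 x * (w1 x * cutoff (R n) x + w x * cutoff' (R n) x)) \<longlonglongrightarrow> w1 x * (w1 x * 1 + w x * 0)"
      by (intro AE_I2 tendsto_intros lim1 lim2)
  qed measurable
  moreover have "(\<lambda>n. - (LINT x|lborel. w2 x * (w x * cutoff (R n) x))) \<longlonglongrightarrow> - (LINT x|lborel. w2 x * (w x * 1))"
  proof (rule tendsto_minus, rule integral_dominated_convergence)
    show "integrable lborel (\<lambda>x. \<bar>w2 x * w x\<bar>)" using integrable_mult_L2[OF L(3) L(1)] by auto
    show "AE x in lborel. norm (w2 x * (w x * cutoff (R n) x)) \<le> \<bar>w2 x * w x\<bar>" for n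
    proof (rule AE_I2)
      fix x
      have "\<bar>w2 x * w x\<bar> * \<bar>cutoff (R n) x\<bar> \<le> \<bar>w2 x * w x\<bar> * 1" using cutoff_bounds by (intro mult_left_mono) auto
      then show "norm (w2 x * (w x * cutoff (R n) x)) \<le> \<bar>w2 x * w x\<bar>" by (simp add: abs_mult mult.assoc)
    qed
    show "AE x in lborel. (\<lambda>n. w2 x * (w x * cutoff (R n) x)) \<longlonglongrightarrow> w2 x * (w x * 1)"
      by (intro AE_I2 tendsto_intros lim1)
  qed measurable
  ultimately have "(LINT x|lborel. w1 x * (w1 x * 1 + w x * 0)) = - (LINT x|lborel. w2 x * (w x * 1))"
    unfolding eq by (rule LIMSEQ_unique)
  then show ?thesis by (simp add: power2_eq_square mult.commute)
qed

section \<open>The free resolvent\<close>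

text \<open>The derivative of the Laplace kernel divided by \<open>k\<close>, with the value 0 at the jump, so that it is
  dominated by the Laplace kernel everywhere.\<close>

definition laplace_kernel' :: "real \<Rightarrow> real \<Rightarrow> real" where
  "laplace_kernel' k z = - (sgn z * laplace_kernel k z)"

lemma laplace_kernel'_measurable [measurable]: "laplace_kernel' k \<in> borel_measurable borel"
  unfolding laplace_kernel'_def[abs_def] by measurable

lemma laplace_kernel'_bound: "0 < k \<Longrightarrow> \<bar>laplace_kernel' k z\<bar> \<le> laplace_kernel k z"
  by (simp add: laplace_kernel'_def abs_mult laplace_kernel_nonneg abs_sgn_eq)

lemma laplace_kernel_bound: "0 < k \<Longrightarrow> \<bar>laplace_kernel k z\<bar> \<le> laplace_kernel k z"
  by (simp add: laplace_kernel_nonneg)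

lemma DERIV_laplace_kernel:
  assumes "x \<noteq> y"
  shows "((\<lambda>x. laplace_kernel k (x - y)) has_real_derivative k * laplace_kernel' k (x - y)) (at x)"
proof -
  have "((\<lambda>t. sgn (x - y) * (t - y)) has_real_derivative sgn (x - y)) (at x)"
    by (auto intro!: derivative_eq_intros)
  then have "((\<lambda>x. \<bar>x - y\<bar>) has_real_derivative sgn (x - y)) (at x)"
    by (rule has_field_derivative_transform_within_open[where S="if y < x then {y<..} else {..<y}"])
      (use assms in \<open>auto split: if_splits\<close>)
  then have "((\<lambda>x. k / 2 * exp (- (k * \<bar>x - y\<bar>))) has_real_derivative k / 2 * (exp (- (k * \<bar>x - y\<bar>)) * - (k * sgn (x - y)))) (at x)"
    by (intro DERIV_cmult DERIV_chain2[OF DERIV_exp] DERIV_minus)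
  then show ?thesis by (simp add: laplace_kernel_def laplace_kernel'_def mult_ac)
qed

lemma continuous_laplace_kernel: "continuous_on S (\<lambda>x. laplace_kernel k (x - y))"
  unfolding laplace_kernel_def by (intro continuous_intros)

lemma isCont_laplace_kernel': 
  assumes "z \<noteq> 0"
  shows "isCont (laplace_kernel' k) z"
  using assms unfolding laplace_kernel'_def laplace_kernel_def
  by (auto intro!: continuous_intros isCont_sgn)

lemma integrable_mult_kernel:
  assumes "0 < k" "a \<in> L2"
  shows "integrable lborel (\<lambda>x. a x * laplace_kernel k (x - y))"
    "integrable lborel (\<lambda>x. a x * laplace_kernel' k (x - y))"
proof -
  have K: "(\<lambda>x. laplace_kernel k (x - y)) \<in> L2"
    using laplace_kernel_L2[OF assms(1), of y] by (simp add: laplace_kernel_minus_commute)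
  show "integrable lborel (\<lambda>x. a x * laplace_kernel k (x - y))" by (rule integrable_mult_L2[OF assms(2) K])
  have "(\<lambda>x. - sgn (x - y) * laplace_kernel k (x - y)) \<in> L2"
    by (rule L2_mult_bounded[OF K, of _ 1]) (auto simp: abs_sgn_eq)
  then show "integrable lborel (\<lambda>x. a x * laplace_kernel' k (x - y))"
    unfolding laplace_kernel'_def using integrable_mult_L2[OF assms(2), of "\<lambda>x. - sgn (x - y) * laplace_kernel k (x - y)"] by simp
qed

context
  fixes k :: real and f :: "real \<Rightarrow> real"
  assumes k: "0 < k" and f: "f \<in> L2"
begin

text \<open>Differentiating the convolution under the integral sign is awkward since the kernel has a corner. In integrated form
  the rule is just the exchange of two integrals and the fundamental theorem of calculus for the kernel.\<close>

lemma conv_kernel_increment: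
  assumes "a \<le> b"
  shows "conv (laplace_kernel k) f b - conv (laplace_kernel k) f a
     = (LINT x|lborel. indicator {a..b} x * (k * conv (laplace_kernel' k) f x))"
proof -
  have inner: "(LINT x|lborel. indicator {a..b} x * (k * laplace_kernel' k (x - y)))
      = laplace_kernel k (b - y) - laplace_kernel k (a - y)" for y
  proof (rule integral_FTC_except[of "{y}"])
    show "integrable lborel (\<lambda>x. indicator {a..b} x * (k * laplace_kernel' k (x - y)))"
      using integrable_mult_right[OF integrable_mult_kernel(2)[OF k L2_indicator[of a b], of y], of k]
      by (simp add: mult.left_commute)
  qed (use assms DERIV_laplace_kernel continuous_laplace_kernel in auto)
  have "(LINT x|lborel. indicator {a..b} x * (k * conv (laplace_kernel' k) f x))
      = k * (LINT x|lborel. indicator {a..b} x * conv (laplace_kernel' k) f x)"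
    by (simp add: mult.left_commute)
  also have "\<dots> = k * (LINT y|lborel. (LINT x|lborel. indicator {a..b} x * laplace_kernel' k (x - y)) * f y)"
    by (subst integral_mult_conv[OF k laplace_kernel'_measurable laplace_kernel'_bound[OF k] f L2_indicator]) simp
  also have "\<dots> = (LINT y|lborel. (laplace_kernel k (b - y) - laplace_kernel k (a - y)) * f y)"
  proof -
    have "k * (LINT x|lborel. indicator {a..b} x * laplace_kernel' k (x - y)) = laplace_kernel k (b - y) - laplace_kernel k (a - y)" for y
      unfolding inner[symmetric] by (simp add: mult.left_commute)
    from this[symmetric] show ?thesis by (simp add: mult.assoc)
  qed
  also have "\<dots> = conv (laplace_kernel k) f b - conv (laplace_kernel k) f a"
    unfolding conv_def left_diff_distrib
    by (intro Bochner_Integration.integral_diff integrable_conv[OF k laplace_kernel_measurable laplace_kernel_bound[OF k] f])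
  finally show ?thesis by simp
qed

lemma continuous_conv_kernel': "continuous_on UNIV (conv (laplace_kernel' k) f)"
  by (rule continuous_conv[OF k laplace_kernel'_measurable laplace_kernel'_bound[OF k] f isCont_laplace_kernel'])

lemma DERIV_conv_kernel:
  "(conv (laplace_kernel k) f has_real_derivative k * conv (laplace_kernel' k) f x) (at x)"
proof -
  let ?w = "conv (laplace_kernel k) f" and ?w1 = "\<lambda>x. k * conv (laplace_kernel' k) f x"
  define a where "a = x - 1"
  have c: "continuous_on {a..x+1} ?w1"
    by (intro continuous_intros continuous_on_subset[OF continuous_conv_kernel']) auto
  have "((\<lambda>t. ?w a + integral {a..t} ?w1) has_real_derivative 0 + ?w1 x) (at x within {a..x+1})"
    by (intro DERIV_add DERIV_const integral_has_real_derivative c) (auto simp: a_def)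
  then have D: "((\<lambda>t. ?w a + integral {a..t} ?w1) has_real_derivative ?w1 x) (at x)"
    by (subst (asm) at_within_interior) (auto simp: a_def)
  have eq: "?w a + integral {a..t} ?w1 = ?w t" if "t \<in> {a<..<x+1}" for t
  proof -
    have "continuous_on {a..t} ?w1" by (rule continuous_on_subset[OF c]) (use that in auto)
    then have "set_integrable lborel {a..t} ?w1" by (rule borel_integrable_atLeastAtMost')
    from set_borel_integral_eq_integral(2)[OF this] conv_kernel_increment[of a t] that
    show ?thesis by (simp only: set_lebesgue_integral_def real_scaleR_def) auto
  qed
  show ?thesis
    by (rule has_field_derivative_transform_within_open[OF D open_greaterThanLessThan _ eq]) (auto simp: a_def)
qed

text \<open>The weak form of \<open>- w'' + k\<^sup>2 w = k\<^sup>2 f\<close>. After the exchange of integrals it reduces to the same equation for the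
  kernel: the jump of the derivative of the kernel across the diagonal produces the point value \<open>\<phi> y\<close>.\<close>

lemma weak_deriv_conv_kernel':
  "weak_deriv (\<lambda>x. k * conv (laplace_kernel' k) f x) (\<lambda>x. k\<^sup>2 * (conv (laplace_kernel k) f x - f x))"
  unfolding weak_deriv_def
proof (intro allI impI, elim conjE)
  fix \<phi> :: "real \<Rightarrow> real"
  assume "\<phi> C1_differentiable_on UNIV" "compact (closure {x. \<phi> x \<noteq> 0})"
  then obtain M where \<phi>: "\<And>x. (\<phi> has_real_derivative deriv \<phi> x) (at x)" "continuous_on UNIV (deriv \<phi>)"
    "continuous_on UNIV \<phi>" "\<And>x. \<phi> x \<noteq> 0 \<Longrightarrow> \<bar>x\<bar> < M" "\<And>x. deriv \<phi> x \<noteq> 0 \<Longrightarrow> \<bar>x\<bar> < M"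
    by (rule test_functionE) blast
  have L: "\<phi> \<in> L2" "deriv \<phi> \<in> L2"
    using continuous_compact_support_L2(1)[of \<phi> M] continuous_compact_support_L2(1)[of "deriv \<phi>" M] \<phi> by auto
  let ?P = "laplace_kernel k" and ?D = "laplace_kernel' k"
  have kernel: "(LINT x|lborel. deriv \<phi> x * ?D (x - y)) = k * \<phi> y - k * (LINT x|lborel. \<phi> x * ?P (x - y))" for y
  proof -
    define B where "B = \<bar>M\<bar> + \<bar>y\<bar> + 1"
    \<comment> \<open>Subtracting the value at the diagonal makes this primitive continuous there, and the jump reappears in its boundary values.\<close>
    define u where "u x = sgn (x - y) * (?P (x - y) * \<phi> x - k / 2 * \<phi> y)" for x
    define u' where "u' x = - (deriv \<phi> x * ?D (x - y)) - k * (\<phi> x * ?P (x - y))" for x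
    have int: "integrable lborel u'" unfolding u'_def
      by (intro Bochner_Integration.integrable_diff Bochner_Integration.integrable_minus integrable_mult_right
          integrable_mult_kernel[OF k] L)
    have ind: "(\<lambda>x. indicator {-B..B} x * u' x) = u'"
    proof
      fix x
      show "indicator {-B..B} x * u' x = u' x"
      proof (cases "x \<in> {-B..B}")
        case False
        then have "\<phi> x = 0" "deriv \<phi> x = 0" using \<phi>(4,5)[of x] by (fastforce simp: B_def)+
        then show ?thesis by (simp add: u'_def)
      qed simp
    qed
    have "(LINT x|lborel. indicator {-B..B} x * u' x) = u B - u (-B)"
    proof (rule integral_FTC_except[of "{y}"])
      show "continuous_on {-B..B} u"
      proof (intro continuous_at_imp_continuous_on ballI)
        fix x
        have g: "isCont (\<lambda>x. ?P (x - y) * \<phi> x - k / 2 * \<phi> y) x"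
          using \<phi>(1)[of x, THEN DERIV_isCont] by (auto simp: laplace_kernel_def intro!: continuous_intros)
        show "isCont u x"
        proof (cases "x = y")
          case False
          then show ?thesis unfolding u_def[abs_def] by (intro isCont_mult[OF isCont_sgn g]) auto
        next
          case True
          have "((\<lambda>x. ?P (x - y) * \<phi> x - k / 2 * \<phi> y) \<longlongrightarrow> 0) (at x)"
            using g True by (simp add: isCont_def laplace_kernel_def)
          then have "(u \<longlongrightarrow> 0) (at x)" unfolding u_def[abs_def]
            by (rule tendsto_0_le[where K=1]) (auto simp: abs_mult abs_sgn_eq)
          then show ?thesis by (simp add: isCont_def u_def True)
        qed
      qed
      fix x assume "x \<in> {-B<..<B} - {y}"
      then have ne: "x \<noteq> y" by simp
      have "((\<lambda>x. ?P (x - y) * \<phi> x - k / 2 * \<phi> y) has_real_derivative k * ?D (x - y) * \<phi> x + deriv \<phi> x * ?P (x - y) - 0) (at x)"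
        by (intro DERIV_diff DERIV_mult DERIV_laplace_kernel ne \<phi>(1) DERIV_const)
      from DERIV_cmult[OF this, of "sgn (x - y)"]
      have "((\<lambda>x'. sgn (x - y) * (?P (x' - y) * \<phi> x' - k / 2 * \<phi> y)) has_real_derivative u' x) (at x)"
        using ne by (simp add: u'_def laplace_kernel'_def algebra_simps sgn_if split: if_splits)
      then show "(u has_real_derivative u' x) (at x)"
      proof (rule has_field_derivative_transform_within_open[where S="if y < x then {y<..} else {..<y}"])
        show "sgn (x - y) * (?P (x' - y) * \<phi> x' - k / 2 * \<phi> y) = u x'" if "x' \<in> (if y < x then {y<..} else {..<y})" for x'
          using that ne by (auto simp: u_def split: if_splits)
      qed (use ne in auto)
    qed (use ind int in \<open>auto simp: B_def\<close>)
    moreover have "\<phi> B = 0" "\<phi> (-B) = 0" using \<phi>(4)[of B] \<phi>(4)[of "-B"] by (fastforce simp: B_def)+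
    then have "u B - u (-B) = - (k * \<phi> y)" by (simp add: u_def B_def)
    ultimately have "(LINT x|lborel. u' x) = - (k * \<phi> y)" unfolding ind by simp
    moreover have "(LINT x|lborel. u' x) = - (LINT x|lborel. deriv \<phi> x * ?D (x - y)) - k * (LINT x|lborel. \<phi> x * ?P (x - y))"
      unfolding u'_def using integrable_mult_kernel[OF k L(2), of y] integrable_mult_kernel[OF k L(1), of y] by simp
    ultimately show ?thesis by simp
  qed
  note conv' = integral_mult_conv[OF k laplace_kernel'_measurable laplace_kernel'_bound[OF k] f L(2)]
  note conv = integral_mult_conv[OF k laplace_kernel_measurable laplace_kernel_bound[OF k] f L(1)]
  have convL2: "conv ?P f \<in> L2" by (rule conv_L2[OF k laplace_kernel_measurable laplace_kernel_bound[OF k] f])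
  have i1: "integrable lborel (\<lambda>y. \<phi> y * f y)" by (rule integrable_mult_L2[OF L(1) f])
  have i2: "integrable lborel (\<lambda>y. (LINT x|lborel. \<phi> x * ?P (x - y)) * f y)"
  proof -
    have "(\<lambda>y. (LINT x|lborel. \<phi> x * ?P (x - y))) = conv ?P \<phi>"
      by (simp add: conv_def[abs_def] laplace_kernel_minus_commute mult.commute fun_eq_iff)
    moreover have "conv ?P \<phi> \<in> L2" by (rule conv_L2[OF k laplace_kernel_measurable laplace_kernel_bound[OF k] L(1)])
    ultimately show ?thesis using integrable_mult_L2 f by simp
  qed
  have i3: "integrable lborel (\<lambda>y. \<phi> y * conv ?P f y)" by (rule integrable_mult_L2[OF L(1) convL2])
  have "(LINT x|lborel. k * conv ?D f x * deriv \<phi> x) = k * (LINT x|lborel. deriv \<phi> x * conv ?D f x)"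
    by (simp add: mult_ac)
  also have "\<dots> = k * (LINT y|lborel. k * (\<phi> y * f y) - k * ((LINT x|lborel. \<phi> x * ?P (x - y)) * f y))"
    unfolding conv' kernel by (simp add: left_diff_distrib mult.assoc)
  also have "\<dots> = k\<^sup>2 * ((LINT y|lborel. \<phi> y * f y) - (LINT x|lborel. \<phi> x * conv ?P f x))"
    unfolding conv using i1 i2 by (simp add: power2_eq_square algebra_simps)
  also have "\<dots> = - (LINT x|lborel. k\<^sup>2 * (\<phi> x * conv ?P f x) - k\<^sup>2 * (\<phi> x * f x))"
    using i1 i3 by (simp add: right_diff_distrib)
  finally show "(LINT x|lborel. k * conv ?D f x * deriv \<phi> x) = - (LINT x|lborel. k\<^sup>2 * (conv ?P f x - f x) * \<phi> x)"
    by (simp add: algebra_simps)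
qed

end

section \<open>Pointwise bound by the energy\<close>

text \<open>The Cauchy-Schwarz inequality for \<open>w1\<close> on the interval between the two points.\<close>

lemma increment_bound:
  assumes d: "\<And>x. (w has_real_derivative w1 x) (at x)" and c: "continuous_on UNIV w1" and L: "w1 \<in> L2"
  shows "(w x - w y)\<^sup>2 \<le> \<bar>x - y\<bar> * (LINT t|lborel. (w1 t)\<^sup>2)"
proof -
  have *: "(w x - w y)\<^sup>2 \<le> (x - y) * (LINT t|lborel. (w1 t)\<^sup>2)" if "y < x" for x y
  proof -
    let ?I = "indicator {y..x} :: real \<Rightarrow> real"
    define m where "m = (w x - w y) / (x - y)"
    have i1: "integrable lborel (\<lambda>t. ?I t * w1 t)"
      using borel_integrable_compact[of "{y..x}" w1] c by (auto intro: continuous_on_subset)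
    have i2: "integrable lborel (\<lambda>t. ?I t * (w1 t)\<^sup>2)"
      using borel_integrable_compact[of "{y..x}" "\<lambda>t. (w1 t)\<^sup>2"] c
      by (auto intro!: continuous_intros intro: continuous_on_subset)
    have i0: "integrable lborel ?I" by (rule integrable_real_indicator) (auto simp: emeasure_lborel_Icc_eq)
    have e: "(LINT t|lborel. ?I t * w1 t) = w x - w y"
      by (rule integral_FTC_except[of "{}"]) (use that d i1 in \<open>auto intro: DERIV_continuous_on has_field_derivative_at_within\<close>)
    have "0 \<le> (LINT t|lborel. ?I t * (w1 t - m)\<^sup>2)" by (rule integral_nonneg_AE) simp
    also have "(\<lambda>t. ?I t * (w1 t - m)\<^sup>2) = (\<lambda>t. ?I t * (w1 t)\<^sup>2 + (- 2 * m) * (?I t * w1 t) + m\<^sup>2 * ?I t)"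
      by (simp add: power2_diff algebra_simps)
    also have "(LINT t|lborel. ?I t * (w1 t)\<^sup>2 + (- 2 * m) * (?I t * w1 t) + m\<^sup>2 * ?I t)
        = (LINT t|lborel. ?I t * (w1 t)\<^sup>2) + (- 2 * m) * (w x - w y) + m\<^sup>2 * (x - y)"
      using i0 i1 i2 e that by simp
    also have "\<dots> = (LINT t|lborel. ?I t * (w1 t)\<^sup>2) - ((w x - w y)\<^sup>2 / (x - y))"
    proof -
      have "m * (x - y) = w x - w y" using that by (simp add: m_def)
      then have "m\<^sup>2 * (x - y) = m * (w x - w y)" by (simp add: power2_eq_square)
      moreover have "(w x - w y)\<^sup>2 / (x - y) = m * (w x - w y)" by (simp add: m_def power2_eq_square)
      ultimately show ?thesis by simp
    qed
    finally have "(w x - w y)\<^sup>2 / (x - y) \<le> (LINT t|lborel. ?I t * (w1 t)\<^sup>2)" by linarith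
    also have "\<dots> \<le> (LINT t|lborel. (w1 t)\<^sup>2)"
      using i2 L2D(2)[OF L] by (intro integral_mono) (auto simp: indicator_def)
    finally show ?thesis using that by (simp add: field_simps)
  qed
  show ?thesis
    using *[of y x] *[of x y] by (cases x y rule: linorder_cases) (auto simp: power2_commute abs_minus_commute)
qed

text \<open>The potential anchors the function: where \<open>V \<ge> e\<close>, the potential energy controls the mean square of \<open>w\<close>, so
  \<open>w\<close> is small at some point \<open>y\<close> of that interval, and from there on it grows at most like the square root of the
  distance.\<close>

lemma pointwise_bound:
  fixes w w1 V :: "real \<Rightarrow> real"
  assumes d: "\<And>x. (w has_real_derivative w1 x) (at x)" and c: "continuous_on UNIV w1" and L: "w1 \<in> L2"
    and Vnn: "\<And>x. 0 \<le> V x" and Vc: "\<And>x. x \<in> {a..b} \<Longrightarrow> e \<le> V x" and ab: "a < b" "0 < e"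
    and int: "integrable lborel (\<lambda>x. V x * (w x)\<^sup>2)"
  shows "(w x)\<^sup>2 \<le> (2 / (e * (b - a)) + 2 * (1 + \<bar>a\<bar> + \<bar>b\<bar>)) * (1 + \<bar>x\<bar>) * (LINT t|lborel. (w1 t)\<^sup>2 + V t * (w t)\<^sup>2)"
proof -
  define Q where "Q = (LINT t|lborel. (w1 t)\<^sup>2 + V t * (w t)\<^sup>2)"
  have Q: "Q = (LINT t|lborel. (w1 t)\<^sup>2) + (LINT t|lborel. V t * (w t)\<^sup>2)"
    unfolding Q_def using int L2D(2)[OF L] by simp
  have nn: "0 \<le> (LINT t|lborel. (w1 t)\<^sup>2)" "0 \<le> (LINT t|lborel. V t * (w t)\<^sup>2)"
    using Vnn by (auto intro!: integral_nonneg_AE)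
  have "\<exists>y\<in>{a..b}. (w y)\<^sup>2 \<le> Q / (e * (b - a))"
  proof (rule ccontr)
    assume "\<not> ?thesis"
    then have gt: "Q / (e * (b - a)) < (w y)\<^sup>2" if "y \<in> {a..b}" for y using that by (meson not_le)
    have w: "continuous_on UNIV w" using d by (auto intro: DERIV_continuous_on)
    obtain y0 where y0: "y0 \<in> {a..b}" "\<And>y. y \<in> {a..b} \<Longrightarrow> (w y0)\<^sup>2 \<le> (w y)\<^sup>2"
      using continuous_attains_inf[of "{a..b}" "\<lambda>y. (w y)\<^sup>2", OF compact_Icc _
          continuous_on_power[OF continuous_on_subset[OF w]]] ab
      by (auto simp: Bex_def)
    have "e * (w y0)\<^sup>2 * (b - a) = (LINT t|lborel. e * (w y0)\<^sup>2 * indicator {a..b} t)" using ab by simp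
    also have "\<dots> \<le> (LINT t|lborel. V t * (w t)\<^sup>2)"
    proof (rule integral_mono[OF _ int])
      show "integrable lborel (\<lambda>t. e * (w y0)\<^sup>2 * indicator {a..b} t)"
        by (intro integrable_mult_right integrable_real_indicator) (auto simp: emeasure_lborel_Icc_eq)
      show "e * (w y0)\<^sup>2 * indicator {a..b} t \<le> V t * (w t)\<^sup>2" for t
        using y0(2)[of t] Vc[of t] Vnn[of t] ab by (cases "t \<in> {a..b}") (auto intro!: mult_mono)
    qed
    also have "\<dots> \<le> Q" using Q nn by simp
    finally have "(w y0)\<^sup>2 \<le> Q / (e * (b - a))" using ab by (simp add: field_simps)
    then show False using gt[OF y0(1)] by simp
  qed
  then obtain y where y: "y \<in> {a..b}" "(w y)\<^sup>2 \<le> Q / (e * (b - a))" by blast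
  have "(w x)\<^sup>2 \<le> 2 * (w y)\<^sup>2 + 2 * (w x - w y)\<^sup>2"
    using zero_le_power2[of "w x - 2 * w y"] by (simp add: power2_eq_square algebra_simps)
  also have "\<dots> \<le> 2 * (Q / (e * (b - a))) + 2 * ((1 + \<bar>a\<bar> + \<bar>b\<bar>) * (1 + \<bar>x\<bar>) * Q)"
  proof -
    have "\<bar>x - y\<bar> \<le> (1 + \<bar>a\<bar> + \<bar>b\<bar>) * (1 + \<bar>x\<bar>)"
    proof -
      have "\<bar>x - y\<bar> \<le> \<bar>x\<bar> + (\<bar>a\<bar> + \<bar>b\<bar>)" using y(1) by auto
      also have "\<dots> \<le> (1 + \<bar>a\<bar> + \<bar>b\<bar>) * (1 + \<bar>x\<bar>)" by (simp add: algebra_simps)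
      finally show ?thesis .
    qed
    then have "\<bar>x - y\<bar> * (LINT t|lborel. (w1 t)\<^sup>2) \<le> (1 + \<bar>a\<bar> + \<bar>b\<bar>) * (1 + \<bar>x\<bar>) * Q"
      using nn Q by (intro mult_mono) auto
    then show ?thesis using increment_bound[OF d c L, of x y] y(2) by linarith
  qed
  also have "\<dots> \<le> (2 / (e * (b - a)) + 2 * (1 + \<bar>a\<bar> + \<bar>b\<bar>)) * (1 + \<bar>x\<bar>) * Q"
  proof -
    have nonneg: "0 \<le> 2 * (Q / (e * (b - a))) * \<bar>x\<bar>" using nn Q ab by auto
    have *: "(2 / A + 2 * L) * (1 + z) * q = 2 * (q / A) + 2 * (q / A) * z + 2 * (L * (1 + z) * q)"
      for A L z q :: real by (simp add: divide_inverse algebra_simps)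
    show ?thesis unfolding * using nonneg by linarith
  qed
  finally show ?thesis unfolding Q_def .
qed

text \<open>A potential in the class is not identically zero, since its first moment is positive.\<close>

lemma potential_positive_interval:
  assumes "V \<in> potentials"
  shows "\<exists>a b c. a < b \<and> 0 < c \<and> (\<forall>x\<in>{a..b}. c \<le> V x)"
proof -
  have "\<exists>x0. 0 < V x0"
  proof (rule ccontr)
    assume "\<nexists>x0. 0 < V x0"
    then have "V x = 0" for x using assms by (auto simp: potentials_def not_less intro: antisym)
    then show False using assms by (simp add: potentials_def)
  qed
  then obtain x0 where x0: "0 < V x0" ..
  have "isCont V x0" using assms by (simp add: potentials_def continuous_on_eq_continuous_at)
  then have "\<forall>\<^sub>F x in at x0. V x0 / 2 < V x"
    unfolding isCont_def using x0 by (intro order_tendstoD(1)) auto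
  then obtain d where d: "0 < d" "\<And>x. x \<noteq> x0 \<Longrightarrow> dist x x0 < d \<Longrightarrow> V x0 / 2 < V x"
    unfolding eventually_at by auto
  have "V x0 / 2 \<le> V x" if "x \<in> {x0..x0 + d / 2}" for x
    using d(2)[of x] d(1) x0 that by (cases "x = x0") (auto simp: dist_real_def)
  then show ?thesis using d(1) x0 by (intro exI[of _ x0] exI[of _ "x0 + d/2"] exI[of _ "V x0 / 2"]) auto
qed

section \<open>The square root of the Schroedinger operator\<close>

lemma selfadjoint_op_L2:
  assumes "selfadjoint_op T" "(f, g) \<in> T"
  shows "f \<in> L2" "g \<in> L2"
  using assms by (auto simp: selfadjoint_op_def)

lemma selfadjoint_op_symmetric:
  assumes "selfadjoint_op T" "(f, g) \<in> T" "(u, v) \<in> T"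
  shows "l2_inner g u = l2_inner f v"
proof -
  have "(u, v) \<in> adjoint_op T" using assms by (auto simp: selfadjoint_op_def)
  then show ?thesis using assms(2) by (auto simp: adjoint_op_def)
qed

lemma potentials_measurable: "V \<in> potentials \<Longrightarrow> V \<in> borel_measurable borel"
  by (auto simp: potentials_def intro: borel_measurable_continuous_onI)

text \<open>Regularisation by \<open>k\<^sup>2 (k\<^sup>2 - d\<^sup>2/dx\<^sup>2)\<^sup>-\<^sup>1\<close> moves any \<open>f\<close> in the domain of \<open>T\<close> into the domain of
  \<open>S = T\<^sup>2\<close>, raises the energy by at most \<open>O(1 / k\<^sup>2)\<close>, and converges to \<open>f\<close>. For \<open>w\<close> in the domain of
  \<open>S\<close> one has \<open>\<langle>w, S w\<rangle> = \<parallel>T w\<parallel>\<^sup>2\<close>, and \<open>\<langle>f, S w\<rangle> = \<langle>T f, T w\<rangle>\<close>. As \<open>S w = k\<^sup>2 (f - w) + V w\<close>, pairing it with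
  \<open>f - w\<close> gives \<open>\<langle>T f, T w\<rangle> - \<parallel>T w\<parallel>\<^sup>2 = k\<^sup>2 \<parallel>f - w\<parallel>\<^sup>2 + \<langle>f - w, V w\<rangle>\<close>, and the two scalar products are
  absorbed by Young's inequality.\<close>

lemma resolvent_energy_bound:
  fixes f g V :: "real \<Rightarrow> real" and k v :: real
  assumes V: "V \<in> potentials" and v: "\<And>x. V x \<le> v"
    and T: "is_sqrt_op (schroedinger_op V) T" and fg: "(f, g) \<in> T" and k: "0 < k"
  defines "w \<equiv> conv (laplace_kernel k) f" and "w1 \<equiv> \<lambda>x. k * conv (laplace_kernel' k) f x"
  shows "(LINT x|lborel. (w1 x)\<^sup>2 + V x * (w x)\<^sup>2) + k\<^sup>2 * (LINT x|lborel. (f x - w x)\<^sup>2)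
    \<le> (LINT x|lborel. (g x)\<^sup>2) + v\<^sup>2 / k\<^sup>2 * (LINT x|lborel. (f x)\<^sup>2)"
proof -
  have sa: "selfadjoint_op T" and comp: "T O T = schroedinger_op V" using T by (auto simp: is_sqrt_op_def)
  note f = selfadjoint_op_L2(1)[OF sa fg] and g = selfadjoint_op_L2(2)[OF sa fg]
  have Vb: "\<bar>V x\<bar> \<le> v" for x using V v[of x] by (simp add: potentials_def)
  note Vm = potentials_measurable[OF V]
  have w: "w \<in> L2" and wf: "(LINT x|lborel. (w x)\<^sup>2) \<le> (LINT x|lborel. (f x)\<^sup>2)"
    unfolding w_def
    by (rule conv_L2 conv_norm_le, rule k, rule laplace_kernel_measurable, rule laplace_kernel_bound[OF k], rule f)+
  have w1: "w1 \<in> L2" unfolding w1_def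
    by (rule L2_cmult, rule conv_L2[OF k laplace_kernel'_measurable laplace_kernel'_bound[OF k] f])
  define w2 where "w2 x = k\<^sup>2 * (w x - f x)" for x
  have w2: "w2 \<in> L2" unfolding w2_def[abs_def] by (intro L2_cmult L2_diff w f)
  have Vw: "(\<lambda>x. V x * w x) \<in> L2" by (rule L2_mult_bounded[OF w Vm Vb])
  \<comment> \<open>This is \<open>S w\<close>, and \<open>u\<close> below is \<open>T w\<close>.\<close>
  define h where "h x = - w2 x + V x * w x" for x
  have h: "h \<in> L2" unfolding h_def[abs_def] using L2_add[OF L2_cmult[OF w2, of "-1"] Vw] by simp
  have dw: "(w has_real_derivative w1 x) (at x)" for x
    unfolding w_def w1_def by (rule DERIV_conv_kernel[OF k f])
  have cw1: "continuous_on UNIV w1"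
    unfolding w1_def by (intro continuous_intros continuous_conv_kernel'[OF k f])
  have wd: "weak_deriv w1 w2"
    using weak_deriv_conv_kernel'[OF k f] unfolding w1_def w2_def[abs_def] w_def .
  have "(w, h) \<in> schroedinger_op V"
    unfolding schroedinger_op_def
    by (simp, intro conjI w h bexI[of _ w1] bexI[of _ w2] w1 w2 wd weak_deriv_C1[OF dw cw1]) (simp add: h_def)
  then obtain u where u: "(w, u) \<in> T" "(u, h) \<in> T" unfolding comp[symmetric] by auto
  note uL = selfadjoint_op_L2(1)[OF sa u(2)]
  define Q where "Q = (LINT x|lborel. (w1 x)\<^sup>2 + V x * (w x)\<^sup>2)"
  have Vw2: "integrable lborel (\<lambda>x. V x * (w x)\<^sup>2)"
    using integrable_mult_L2[OF Vw w] by (simp add: power2_eq_square mult.assoc)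
  have "(LINT x|lborel. w x * h x) = - (LINT x|lborel. w x * w2 x) + (LINT x|lborel. V x * (w x)\<^sup>2)"
    using integrable_mult_L2[OF w w2] Vw2 by (simp add: h_def algebra_simps power2_eq_square)
  also have "\<dots> = Q"
    unfolding energy_identity[OF dw cw1 w w1 w2 wd] Q_def using L2D(2)[OF w1] Vw2 by simp
  finally have wh: "(LINT x|lborel. w x * h x) = Q" .
  have uu: "(LINT x|lborel. (u x)\<^sup>2) = Q"
    using selfadjoint_op_symmetric[OF sa u(1) u(2)] wh by (simp add: l2_inner_def power2_eq_square)
  have gu: "(LINT x|lborel. g x * u x) = (LINT x|lborel. f x * h x)"
    using selfadjoint_op_symmetric[OF sa fg u(2)] by (simp add: l2_inner_def)
  have fw: "(\<lambda>x. f x - w x) \<in> L2" by (rule L2_diff[OF f w])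
  define d where "d = (LINT x|lborel. (f x - w x)\<^sup>2)"
  define c where "c = (LINT x|lborel. (f x - w x) * (V x * w x))"
  have "(LINT x|lborel. f x * h x) - (LINT x|lborel. w x * h x) = (LINT x|lborel. (f x - w x) * h x)"
    using integrable_mult_L2[OF f h] integrable_mult_L2[OF w h] by (simp add: left_diff_distrib)
  also have "\<dots> = (LINT x|lborel. k\<^sup>2 * (f x - w x)\<^sup>2 + (f x - w x) * (V x * w x))"
    by (rule Bochner_Integration.integral_cong) (auto simp: h_def w2_def power2_eq_square algebra_simps)
  also have "\<dots> = k\<^sup>2 * d + c"
    unfolding d_def c_def using L2D(2)[OF fw] integrable_mult_L2[OF fw Vw] by simp
  finally have key: "(LINT x|lborel. g x * u x) - Q = k\<^sup>2 * d + c" using gu wh by simp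
  have gu_le: "2 * (LINT x|lborel. g x * u x) \<le> (LINT x|lborel. (g x)\<^sup>2) + Q"
  proof -
    have "(LINT x|lborel. 2 * (g x * u x)) \<le> (LINT x|lborel. (g x)\<^sup>2 + (u x)\<^sup>2)"
      using integrable_mult_L2[OF g uL] L2D(2)[OF g] L2D(2)[OF uL] sum_squares_bound[of "g _" "u _"]
      by (intro integral_mono) (auto simp: mult.assoc)
    then show ?thesis using L2D(2)[OF g] L2D(2)[OF uL] uu by simp
  qed
  have c_ge: "- (k\<^sup>2 * d) - v\<^sup>2 / k\<^sup>2 * (LINT x|lborel. (f x)\<^sup>2) \<le> 2 * c"
  proof -
    have "(LINT x|lborel. - (k\<^sup>2 * (f x - w x)\<^sup>2) - v\<^sup>2 / k\<^sup>2 * (w x)\<^sup>2) \<le> (LINT x|lborel. 2 * ((f x - w x) * (V x * w x)))"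
    proof (rule integral_mono)
      fix x
      have "0 \<le> (k * (f x - w x) + V x * w x / k)\<^sup>2" by simp
      also have "\<dots> = k\<^sup>2 * (f x - w x)\<^sup>2 + 2 * ((f x - w x) * (V x * w x)) + (V x)\<^sup>2 * ((w x)\<^sup>2 / k\<^sup>2)"
        using k by (simp add: power2_sum power_mult_distrib power_divide)
      finally have "- (k\<^sup>2 * (f x - w x)\<^sup>2) - (V x)\<^sup>2 * ((w x)\<^sup>2 / k\<^sup>2) \<le> 2 * ((f x - w x) * (V x * w x))" by linarith
      moreover have "(V x)\<^sup>2 * ((w x)\<^sup>2 / k\<^sup>2) \<le> v\<^sup>2 * ((w x)\<^sup>2 / k\<^sup>2)"
        using Vb[of x] by (intro mult_right_mono) (auto intro: power2_le_iff_abs_le[THEN iffD2])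
      ultimately show "- (k\<^sup>2 * (f x - w x)\<^sup>2) - v\<^sup>2 / k\<^sup>2 * (w x)\<^sup>2 \<le> 2 * ((f x - w x) * (V x * w x))" by simp
    qed (use L2D(2)[OF fw] L2D(2)[OF w] integrable_mult_L2[OF fw Vw] in auto)
    then have "- (k\<^sup>2 * d) - v\<^sup>2 / k\<^sup>2 * (LINT x|lborel. (w x)\<^sup>2) \<le> 2 * c"
      unfolding d_def c_def using L2D(2)[OF fw] L2D(2)[OF w] by simp
    moreover have "v\<^sup>2 / k\<^sup>2 * (LINT x|lborel. (w x)\<^sup>2) \<le> v\<^sup>2 / k\<^sup>2 * (LINT x|lborel. (f x)\<^sup>2)"
      using wf by (intro mult_left_mono) auto
    ultimately show ?thesis by linarith
  qed
  show ?thesis using key gu_le c_ge unfolding Q_def[symmetric] d_def[symmetric] by argo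
qed

text \<open>The pointwise bound passes from the regularised functions to \<open>f\<close> along a subsequence that converges almost
  everywhere.\<close>

lemma sqrt_op_pointwise_bound:
  assumes V: "V \<in> potentials" and T: "is_sqrt_op (schroedinger_op V) T"
  shows "\<exists>K>0. \<forall>f g. (f, g) \<in> T \<longrightarrow> (AE x in lborel. (f x)\<^sup>2 \<le> K * (1 + \<bar>x\<bar>) * (LINT x|lborel. (g x)\<^sup>2))"
proof -
  obtain v where v: "\<And>x. V x \<le> v" 
    using V by (auto simp: potentials_def bounded_iff) (meson abs_le_D1)
  obtain a b e where ab: "a < b" "0 < e" "\<And>x. x \<in> {a..b} \<Longrightarrow> e \<le> V x"
    using potential_positive_interval[OF V] by blast
  define K where "K = 2 / (e * (b - a)) + 2 * (1 + \<bar>a\<bar> + \<bar>b\<bar>)"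
  have K: "0 < K" using ab unfolding K_def by (intro add_pos_nonneg divide_pos_pos mult_pos_pos) auto
  have Vnn: "0 \<le> V x" for x using V by (simp add: potentials_def)
  have Vb: "\<bar>V x\<bar> \<le> v" for x using v[of x] Vnn[of x] by simp
  have sa: "selfadjoint_op T" using T by (auto simp: is_sqrt_op_def)
  have "AE x in lborel. (f x)\<^sup>2 \<le> K * (1 + \<bar>x\<bar>) * (LINT x|lborel. (g x)\<^sup>2)" if fg: "(f, g) \<in> T" for f g
  proof -
    note f = selfadjoint_op_L2(1)[OF sa fg]
    define k where "k n = real n + 1" for n :: nat
    define w where "w n = conv (laplace_kernel (k n)) f" for n
    define F where "F = v\<^sup>2 * (LINT x|lborel. (f x)\<^sup>2)"
    define G where "G = (LINT x|lborel. (g x)\<^sup>2)"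
    define Q where "Q n = (LINT x|lborel. (k n * conv (laplace_kernel' (k n)) f x)\<^sup>2 + V x * (w n x)\<^sup>2)" for n
    have k: "0 < k n" for n by (simp add: k_def)
    have kinf: "filterlim k at_top sequentially"
      unfolding k_def[abs_def]
      by (rule filterlim_tendsto_add_at_top[OF tendsto_const filterlim_real_sequentially, of 1, simplified add.commute[of 1]])
    have lim0: "(\<lambda>n. C / (k n)\<^sup>2) \<longlonglongrightarrow> 0" for C :: real
      by (intro tendsto_divide_0[OF tendsto_const] filterlim_at_top_imp_at_infinity filterlim_pow_at_top kinf) auto
    have F: "0 \<le> F" by (auto simp: F_def intro!: mult_nonneg_nonneg integral_nonneg_AE)
    have Q: "0 \<le> Q n" for n unfolding Q_def using Vnn by (intro integral_nonneg_AE) auto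
    have wL: "w n \<in> L2" for n unfolding w_def
      by (rule conv_L2[OF k laplace_kernel_measurable laplace_kernel_bound[OF k] f])
    have energy: "Q n + (k n)\<^sup>2 * (LINT x|lborel. (f x - w n x)\<^sup>2) \<le> G + F / (k n)\<^sup>2" for n
      using resolvent_energy_bound[OF V v T fg k[of n]] unfolding Q_def w_def G_def F_def by simp
    have QG: "Q n \<le> G + F / (k n)\<^sup>2" for n
    proof -
      have "0 \<le> (k n)\<^sup>2 * (LINT x|lborel. (f x - w n x)\<^sup>2)" by (intro mult_nonneg_nonneg integral_nonneg_AE) auto
      then show ?thesis using energy[of n] by linarith
    qed
    have dist: "(LINT x|lborel. (f x - w n x)\<^sup>2) \<le> (G + F) / (k n)\<^sup>2" for n
    proof -
      have "1 \<le> (k n)\<^sup>2" by (simp add: k_def)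
      then have "F / (k n)\<^sup>2 \<le> F / 1" using F by (intro divide_left_mono) auto
      then have "(k n)\<^sup>2 * (LINT x|lborel. (f x - w n x)\<^sup>2) \<le> G + F" using energy[of n] Q[of n] by linarith
      then show ?thesis using k[of n] by (simp add: field_simps)
    qed
    have pw: "(w n x)\<^sup>2 \<le> K * (1 + \<bar>x\<bar>) * (G + F / (k n)\<^sup>2)" for n x
    proof -
      have VwL: "(\<lambda>x. V x * w n x) \<in> L2" by (rule L2_mult_bounded[OF wL potentials_measurable[OF V] Vb])
      have Vw2: "integrable lborel (\<lambda>x. V x * (w n x)\<^sup>2)"
        using integrable_mult_L2[OF VwL wL, of n] by (simp add: power2_eq_square mult.assoc)
      have "(w n x)\<^sup>2 \<le> K * (1 + \<bar>x\<bar>) * Q n"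
        unfolding K_def Q_def
      proof (rule pointwise_bound[OF _ _ _ Vnn ab(3) ab(1,2) Vw2])
        show "(w n has_real_derivative k n * conv (laplace_kernel' (k n)) f x) (at x)" for x
          unfolding w_def by (rule DERIV_conv_kernel[OF k f])
        show "continuous_on UNIV (\<lambda>x. k n * conv (laplace_kernel' (k n)) f x)"
          by (intro continuous_intros continuous_conv_kernel'[OF k f])
        show "(\<lambda>x. k n * conv (laplace_kernel' (k n)) f x) \<in> L2"
          by (rule L2_cmult, rule conv_L2[OF k laplace_kernel'_measurable laplace_kernel'_bound[OF k] f])
      qed
      also have "\<dots> \<le> K * (1 + \<bar>x\<bar>) * (G + F / (k n)\<^sup>2)"
        using K QG[of n] by (intro mult_left_mono) auto
      finally show ?thesis .
    qed
    have "(\<lambda>n. LINT x|lborel. norm ((f x - w n x)\<^sup>2)) \<longlonglongrightarrow> 0"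
      by (rule tendsto_sandwich[OF _ _ tendsto_const lim0[of "G + F"]]) (use dist in auto)
    then obtain r where r: "strict_mono r" "AE x in lborel. (\<lambda>n. (f x - w (r n) x)\<^sup>2) \<longlonglongrightarrow> 0"
      using tendsto_L1_AE_subseq[of lborel "\<lambda>n x. (f x - w n x)\<^sup>2"] L2D(2)[OF L2_diff[OF f wL]] by blast
    from r(2) show ?thesis unfolding G_def[symmetric]
    proof eventually_elim
      case (elim x)
      then have "(\<lambda>n. \<bar>f x - w (r n) x\<bar>) \<longlonglongrightarrow> 0"
        using tendsto_real_sqrt[OF elim] by simp
      then have "(\<lambda>n. f x - w (r n) x) \<longlonglongrightarrow> 0" by (rule tendsto_rabs_zero_cancel)
      from tendsto_diff[OF tendsto_const this, of "f x"] have "(\<lambda>n. (w (r n) x)\<^sup>2) \<longlonglongrightarrow> (f x)\<^sup>2"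
        by (intro tendsto_power) simp
      moreover have "(\<lambda>n. K * (1 + \<bar>x\<bar>) * (G + F / (k (r n))\<^sup>2)) \<longlonglongrightarrow> K * (1 + \<bar>x\<bar>) * (G + 0)"
        using LIMSEQ_subseq_LIMSEQ[OF lim0[of F] r(1)] by (intro tendsto_intros) (simp add: o_def)
      ultimately have "(f x)\<^sup>2 \<le> K * (1 + \<bar>x\<bar>) * (G + 0)"
        by (rule LIMSEQ_le) (use pw in auto)
      then show ?case by simp
    qed
  qed
  then show ?thesis using K by blast
qed

section \<open>Growth of the zero-energy solutions\<close>

text \<open>A positive solution is convex, and its slope strictly increases across \<open>x0\<close>, as \<open>V x0 > 0\<close>. An increasing one therefore has a
  positive slope somewhere and lies above a tangent line of that slope.\<close>

lemma convex_solution_linear_growth: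
  fixes \<psi> p V :: "real \<Rightarrow> real"
  assumes d1: "\<And>x. (\<psi> has_real_derivative p x) (at x)"
    and d2: "\<And>x. (p has_real_derivative V x * \<psi> x) (at x)"
    and V: "\<And>x. 0 \<le> V x" "0 < V x0" and pos: "\<And>x. 0 < \<psi> x" and mono: "mono \<psi>"
  shows "\<exists>c>0. \<forall>x\<ge>0. c * (1 + x) \<le> \<psi> x"
proof -
  have p_mono: "p x \<le> p y" if "x \<le> y" for x y
    by (rule DERIV_nonneg_imp_nondecreasing[OF that]) (use d2 V(1) pos in \<open>meson less_imp_le mult_nonneg_nonneg\<close>)
  have p_nonneg: "0 \<le> p x" for x
    using mono_on_imp_deriv_nonneg[of UNIV \<psi> "p x" x] d1[of x] mono by auto
  obtain e where e: "0 < e" "\<And>h. 0 < h \<Longrightarrow> h < e \<Longrightarrow> p x0 < p (x0 + h)"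
    using DERIV_pos_inc_right[OF d2[of x0]] V(2) pos[of x0] by auto
  define x1 where "x1 = x0 + e / 2"
  have p1: "0 < p x1" using e(2)[of "e/2"] e(1) p_nonneg[of x0] by (simp add: x1_def)
  have lin: "p x1 * (x - x1) \<le> \<psi> x" for x
  proof (cases "x1 < x")
    case True
    obtain z where z: "x1 < z" "z < x" "\<psi> x - \<psi> x1 = (x - x1) * p z"
      using MVT2[OF True, of \<psi> p] d1 by blast
    have "(x - x1) * p x1 \<le> (x - x1) * p z"
      using True p_mono[of x1 z] z(1) by (intro mult_left_mono) auto
    then show ?thesis using z(3) pos[of x1] by (simp add: mult.commute)
  next
    case False
    then have "p x1 * (x - x1) \<le> 0" using p1 by (intro mult_nonneg_nonpos) auto
    then show ?thesis using pos[of x] by linarith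
  qed
  \<comment> \<open>The tangent line is useful only to the right of \<open>x1\<close>; before, \<open>\<psi> 0\<close> is the lower bound. The sum covers both.\<close>
  define D where "D = 1 / p x1 + (1 + \<bar>x1\<bar>) / \<psi> 0"
  have D: "0 < D" using p1 pos[of 0] by (auto simp: D_def intro!: add_pos_pos)
  have "1 + x \<le> D * \<psi> x" if "0 \<le> x" for x
  proof -
    have "x - x1 \<le> \<psi> x / p x1" using lin[of x] p1 by (simp add: field_simps)
    moreover have "\<psi> 0 \<le> \<psi> x" using mono that by (simp add: monoD)
    then have "(1 + \<bar>x1\<bar>) * 1 \<le> (1 + \<bar>x1\<bar>) * (\<psi> x / \<psi> 0)"
      using pos[of 0] by (intro mult_left_mono) auto
    ultimately show ?thesis by (simp add: D_def distrib_right)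
  qed
  then show ?thesis using D
    by (intro exI[of _ "1 / D"]) (auto simp: field_simps)
qed

text \<open>The increasing solution grows on the right. Reflection turns the decreasing one into an increasing solution
  for the reflected potential, which gives the growth on the left.\<close>

lemma psi_V_linear_growth:
  assumes "V \<in> potentials" "is_psi_V V \<psi>" "0 < V x0"
  shows "\<exists>c>0. \<forall>x. c * (1 + \<bar>x\<bar>) \<le> \<psi> x"
proof -
  obtain \<psi>1 \<psi>2 where psi: "is_psi1 V \<psi>1" "is_psi2 V \<psi>2" "\<psi> = (\<lambda>x. \<psi>1 x + \<psi>2 x)"
    using assms(2) by (auto simp: is_psi_V_def)
  have Vnn: "0 \<le> V x" for x using assms(1) by (auto simp: potentials_def)
  have ode: "(\<phi> has_real_derivative deriv \<phi> x) (at x) \<and> (deriv \<phi> has_real_derivative V x * \<phi> x) (at x)"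
    if "zero_energy_solution V \<phi>" for \<phi> x
  proof -
    have "\<phi> differentiable (at x)" "deriv \<phi> differentiable (at x)" "deriv (deriv \<phi>) x = V x * \<phi> x"
      using that by (auto simp: zero_energy_solution_def algebra_simps)
    then show ?thesis by (metis DERIV_deriv_iff_real_differentiable)
  qed
  note ode1 = ode[of \<psi>1] and ode2 = ode[of \<psi>2]
  obtain c1 where c1: "0 < c1" "\<And>x. 0 \<le> x \<Longrightarrow> c1 * (1 + x) \<le> \<psi>1 x"
    using convex_solution_linear_growth[of \<psi>1 "deriv \<psi>1" V x0] ode1 psi(1) Vnn assms(3)
    by (auto simp: is_psi1_def)
  have "\<exists>c>0. \<forall>x\<ge>0. c * (1 + x) \<le> \<psi>2 (- x)"
  proof (rule convex_solution_linear_growth[of _ "\<lambda>x. - deriv \<psi>2 (- x)" "\<lambda>x. V (- x)" "- x0"])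
    fix x
    have "(\<psi>2 has_real_derivative deriv \<psi>2 (-x)) (at (-x))"
      "(deriv \<psi>2 has_real_derivative V (-x) * \<psi>2 (-x)) (at (-x))"
      using ode2[of "-x"] psi(2) by (auto simp: is_psi2_def)
    from this[THEN DERIV_mirror[THEN iffD1]]
    show "((\<lambda>x. \<psi>2 (- x)) has_real_derivative - deriv \<psi>2 (- x)) (at x)"
      "((\<lambda>x. - deriv \<psi>2 (- x)) has_real_derivative V (- x) * \<psi>2 (- x)) (at x)"
      using DERIV_minus by fastforce+
    show "0 < \<psi>2 (- x)" using psi(2) by (auto simp: is_psi2_def)
    show "mono (\<lambda>x. \<psi>2 (- x))" using psi(2) by (auto simp: is_psi2_def monotone_def)
  qed (use Vnn assms(3) in auto)
  then obtain c2 where c2: "0 < c2" "\<And>x. 0 \<le> x \<Longrightarrow> c2 * (1 + x) \<le> \<psi>2 (- x)" by auto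
  have "min c1 c2 * (1 + \<bar>x\<bar>) \<le> \<psi> x" for x
  proof (cases "0 \<le> x")
    case True
    then have "min c1 c2 * (1 + \<bar>x\<bar>) \<le> c1 * (1 + x)" by (auto intro!: mult_right_mono)
    moreover have "0 < \<psi>2 x" using psi(2) by (auto simp: is_psi2_def)
    ultimately show ?thesis using c1(2)[OF True] psi(3) by simp
  next
    case False
    then have "min c1 c2 * (1 + \<bar>x\<bar>) \<le> c2 * (1 + (- x))" by (auto intro!: mult_right_mono)
    moreover have "0 < \<psi>1 x" using psi(1) by (auto simp: is_psi1_def)
    moreover have "c2 * (1 + (- x)) \<le> \<psi>2 x" using c2(2)[of "- x"] False by simp
    ultimately show ?thesis unfolding psi(3) by linarith
  qed
  then show ?thesis using c1(1) c2(1) by (intro exI[of _ "min c1 c2"]) auto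
qed

lemma psi_V_measurable:
  assumes "is_psi_V V \<psi>"
  shows "\<psi> \<in> borel_measurable borel"
proof -
  have "continuous_on UNIV \<phi>" if "zero_energy_solution V \<phi>" for \<phi>
    using that by (auto simp: zero_energy_solution_def continuous_on_eq_continuous_at
        intro: differentiable_imp_continuous_within)
  then show ?thesis using assms
    by (auto simp: is_psi_V_def is_psi1_def is_psi2_def intro!: borel_measurable_continuous_onI continuous_intros)
qed

section \<open>From the pointwise bound to the Nash inequality\<close>

text \<open>The two terms bound the part of \<open>\<integral> f\<^sup>2\<close> inside and outside \<open>[-R, R]\<close>. They balance for
  \<open>(1 + R)\<^sup>5\<^sup>/\<^sup>2 = M / \<surd>G\<close>, which is a legitimate choice if the right-hand side is at least 1. Otherwise \<open>R = 0\<close> is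
  good enough, because \<open>M \<surd>G \<le> M\<^sup>4\<^sup>/\<^sup>5 G\<^sup>3\<^sup>/\<^sup>5\<close> when \<open>M \<le> \<surd>G\<close>;
  the choice \<open>R = 0\<close> also settles the case \<open>G = 0\<close>, where it gives \<open>N = 0\<close>.\<close>

lemma nash_optimisation:
  fixes N M G K c :: real
  assumes nn: "0 \<le> N" "0 \<le> M" "0 \<le> G" and K: "0 < K" and c: "0 < c"
    and le: "\<And>R. 0 \<le> R \<Longrightarrow> N \<le> 2 * R * (1 + R) * (K * G) + M / c * sqrt (K * G) * (1 + R) powr (- 1 / 2)"
  shows "N powr (5 / 3) \<le> (2 * K + sqrt K / c) powr (5 / 3) * M powr (4 / 3) * G"
proof -
  define A where "A = 2 * K + sqrt K / c"
  have A: "0 < A" using K c by (auto simp: A_def intro!: add_pos_pos)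
  have zero: "N \<le> A * (M * sqrt G)"
  proof -
    have "N \<le> sqrt K / c * (M * sqrt G)" using le[of 0] by (simp add: real_sqrt_mult mult_ac)
    also have "\<dots> \<le> A * (M * sqrt G)" using nn K by (intro mult_right_mono) (auto simp: A_def)
    finally show ?thesis .
  qed
  have "N \<le> A * (M powr (4 / 5) * G powr (3 / 5))"
  proof (cases "M \<le> sqrt G")
    case True
    show ?thesis
    proof (cases "M = 0")
      case False
      then have M: "0 < M" "0 < G" using nn True by (auto simp: less_le)
      have "M powr (1 / 5) \<le> sqrt G powr (1 / 5)" using M True by (intro powr_mono2) auto
      also have "\<dots> = G powr (1 / 10)" using M by (simp add: powr_half_sqrt[symmetric] powr_powr)
      finally have "M powr (4 / 5) * M powr (1 / 5) * G powr (1 / 2) \<le> M powr (4 / 5) * G powr (1 / 10) * G powr (1 / 2)"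
        by (intro mult_right_mono mult_left_mono) auto
      moreover have "M powr (4 / 5) * M powr (1 / 5) = M" using M by (simp flip: powr_add)
      moreover have "G powr (1 / 10) * G powr (1 / 2) = G powr (3 / 5)" by (simp flip: powr_add)
      moreover have "G powr (1 / 2) = sqrt G" using M by (simp add: powr_half_sqrt)
      ultimately have "M * sqrt G \<le> M powr (4 / 5) * G powr (3 / 5)"
        by (simp only: mult.assoc)
      then have "A * (M * sqrt G) \<le> A * (M powr (4 / 5) * G powr (3 / 5))" using A by simp
      then show ?thesis using zero by linarith
    qed (use zero in simp)
  next
    case False
    then have M: "0 < M" using nn by (smt (verit) real_sqrt_ge_zero)
    show ?thesis
    proof (cases "G = 0")
      case False
      then have G: "0 < G" using nn by simp
      \<comment> \<open>The value of \<open>1 + R\<close> at which both contributions have the same order.\<close>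
      define q where "q = M / sqrt G"
      define \<rho> where "\<rho> = q powr (2 / 5)"
      have q: "1 < q" using \<open>\<not> M \<le> sqrt G\<close> G by (simp add: q_def)
      have Mq: "M = q * sqrt G" using G by (simp add: q_def)
      have \<rho>: "1 < \<rho>" using q by (simp add: \<rho>_def gr_one_powr)
      have "2 * (\<rho> - 1) * \<rho> * (K * G) \<le> 2 * K * (\<rho> powr 2 * G)"
      proof -
        have "(\<rho> - 1) * \<rho> \<le> \<rho> * \<rho>" using \<rho> by (intro mult_right_mono) auto
        then have "(\<rho> - 1) * \<rho> * (2 * K * G) \<le> \<rho> * \<rho> * (2 * K * G)" using K G \<rho> by (intro mult_right_mono) auto
        then show ?thesis using \<rho> by (simp add: power2_eq_square mult_ac)
      qed
      moreover have "M / c * sqrt (K * G) * \<rho> powr (- 1 / 2) = sqrt K / c * (q powr (4 / 5) * G)"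
      proof -
        have "q * \<rho> powr (- 1 / 2) = q powr (4 / 5)"
          using q powr_add[of q 1 "- 1 / 5"] by (simp add: \<rho>_def powr_powr)
        moreover have "sqrt G * sqrt G = G" using G by simp
        moreover have "M / c * sqrt (K * G) * \<rho> powr (- 1 / 2) = sqrt K / c * (q * \<rho> powr (- 1 / 2) * (sqrt G * sqrt G))"
          unfolding Mq by (simp add: real_sqrt_mult)
        ultimately show ?thesis by simp
      qed
      moreover have "\<rho> powr 2 = q powr (4 / 5)" by (simp add: \<rho>_def powr_powr)
      moreover have "N \<le> 2 * (\<rho> - 1) * \<rho> * (K * G) + M / c * sqrt (K * G) * \<rho> powr (- 1 / 2)"
        using le[of "\<rho> - 1"] \<rho> by simp
      ultimately have "N \<le> 2 * K * (q powr (4 / 5) * G) + sqrt K / c * (q powr (4 / 5) * G)" by (simp only:)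
      then have "N \<le> A * (q powr (4 / 5) * G)" unfolding A_def by (simp only: distrib_right)
      also have "q powr (4 / 5) * G = M powr (4 / 5) * G powr (3 / 5)"
      proof -
        have "sqrt G powr (4 / 5) = G powr (2 / 5)" using G by (simp add: powr_half_sqrt[symmetric] powr_powr)
        moreover have "G powr (2 / 5) * G powr (3 / 5) = G" using G by (simp flip: powr_add)
        moreover have "M powr (4 / 5) = q powr (4 / 5) * sqrt G powr (4 / 5)"
          unfolding Mq using q G by (simp add: powr_mult)
        ultimately show ?thesis by simp
      qed
      finally show ?thesis .
    qed (use zero in simp)
  qed
  then have "N powr (5 / 3) \<le> (A * (M powr (4 / 5) * G powr (3 / 5))) powr (5 / 3)"
    using nn by (intro powr_mono2) auto
  also have "\<dots> = A powr (5 / 3) * M powr (4 / 3) * G"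
    using nn A by (cases "G = 0") (auto simp: powr_mult powr_powr)
  finally show ?thesis unfolding A_def .
qed

text \<open>Inside \<open>[-R, R]\<close> the pointwise bound is integrated directly. Outside, it is used for only one of the two
  factors of \<open>f\<^sup>2 = \<bar>f\<bar> \<bar>f\<bar>\<close>: compared with the weight \<open>\<psi> \<ge> c (1 + \<bar>x\<bar>)\<close> it gains \<open>(1 + \<bar>x\<bar>)\<^sup>-\<^sup>1\<^sup>/\<^sup>2\<close>, and the
  other factor is absorbed by the weighted \<open>L\<^sup>1\<close> norm.\<close>

lemma nash_from_pointwise_bound:
  fixes f \<psi> :: "real \<Rightarrow> real"
  assumes f: "f \<in> L2" and \<psi>: "\<And>x. c * (1 + \<bar>x\<bar>) \<le> \<psi> x" and c: "0 < c"
    and int: "integrable lborel (\<lambda>x. \<psi> x * f x)" and K: "0 < K" and G: "0 \<le> G"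
    and bound: "AE x in lborel. (f x)\<^sup>2 \<le> K * (1 + \<bar>x\<bar>) * G"
  shows "(LINT x|lborel. (f x)\<^sup>2) powr (5 / 3) \<le> (2 * K + sqrt K / c) powr (5 / 3) * l1_norm (\<lambda>x. \<psi> x * f x) powr (4 / 3) * G"
proof (rule nash_optimisation)
  fix R :: real assume R: "0 \<le> R"
  define B where "B = sqrt (K * G) * (1 + R) powr (- 1 / 2) / c"
  have B: "0 \<le> B" using K G c by (simp add: B_def)
  have KG: "0 \<le> K * G" using K G by simp
  have pw: "AE x in lborel. (f x)\<^sup>2 \<le> (1 + R) * (K * G) * indicator {-R..R} x + B * \<bar>\<psi> x * f x\<bar>"
    using bound
  proof eventually_elim
    case (elim x)
    show ?case
    proof (cases "\<bar>x\<bar> \<le> R")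
      case True
      then have "K * (1 + \<bar>x\<bar>) * G \<le> (1 + R) * (K * G)"
        using mult_right_mono[OF _ KG, of "1 + \<bar>x\<bar>" "1 + R"] by (simp add: mult_ac)
      moreover have "x \<in> {-R..R}" "0 \<le> B * \<bar>\<psi> x * f x\<bar>" using True B by auto
      ultimately show ?thesis using elim by simp
    next
      case False
      define s where "s = sqrt (1 + \<bar>x\<bar>)"
      have s: "0 < s" "s * s = 1 + \<bar>x\<bar>" by (auto simp: s_def)
      have "1 / s \<le> 1 / sqrt (1 + R)" using False R by (auto simp: s_def intro!: divide_left_mono)
      also have "\<dots> = (1 + R) powr (- 1 / 2)"
        using R by (simp add: powr_minus_divide powr_half_sqrt)
      finally have sR: "1 / s \<le> (1 + R) powr (- 1 / 2)" .
      have "\<bar>f x\<bar> \<le> sqrt (K * G * (s * s))"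
        using elim by (intro real_le_rsqrt) (simp add: s mult_ac)
      also have "\<dots> = sqrt (K * G) * s" using s(1) by (simp only: real_sqrt_mult real_sqrt_mult_self abs_of_pos)
      finally have fs: "\<bar>f x\<bar> \<le> sqrt (K * G) * s" .
      have "(f x)\<^sup>2 = \<bar>f x\<bar> * \<bar>f x\<bar>" by (simp add: power2_eq_square)
      also have "\<dots> \<le> (sqrt (K * G) * s) * \<bar>f x\<bar>" using fs by (intro mult_right_mono) auto
      also have "\<dots> = sqrt (K * G) * (1 / s) * (s * s) * \<bar>f x\<bar>" using s(1) by simp
      also have "\<dots> \<le> sqrt (K * G) * (1 + R) powr (- 1 / 2) * (s * s) * \<bar>f x\<bar>"
        using sR s KG by (intro mult_right_mono mult_left_mono) auto
      also have "\<dots> = B * (c * (1 + \<bar>x\<bar>) * \<bar>f x\<bar>)" using c by (simp add: B_def s)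
      also have "\<dots> \<le> B * (\<bar>\<psi> x\<bar> * \<bar>f x\<bar>)" using B \<psi>[of x] by (intro mult_left_mono mult_right_mono) auto
      finally show ?thesis using KG R by (simp add: abs_mult add_increasing)
    qed
  qed
  have ind: "integrable lborel (\<lambda>x. (1 + R) * (K * G) * indicator {-R..R} x :: real)"
    by (intro integrable_mult_right integrable_real_indicator) (auto simp: emeasure_lborel_Icc_eq)
  have "(LINT x|lborel. (f x)\<^sup>2) \<le> (LINT x|lborel. (1 + R) * (K * G) * indicator {-R..R} x + B * \<bar>\<psi> x * f x\<bar>)"
    using f ind int pw by (intro integral_mono_AE) (auto simp: L2_def)
  also have "\<dots> = (LINT x|lborel. (1 + R) * (K * G) * indicator {-R..R} x) + B * l1_norm (\<lambda>x. \<psi> x * f x)"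
    using int ind by (subst Bochner_Integration.integral_add) (auto simp: l1_norm_def)
  also have "(LINT x|lborel. (1 + R) * (K * G) * indicator {-R..R} x) = (1 + R) * (K * G) * (2 * R)"
    using R by simp
  finally show "(LINT x|lborel. (f x)\<^sup>2) \<le> 2 * R * (1 + R) * (K * G) + l1_norm (\<lambda>x. \<psi> x * f x) / c * sqrt (K * G) * (1 + R) powr (- 1 / 2)"
    by (simp add: B_def mult_ac)
qed (use K G c in \<open>auto simp: l1_norm_def\<close>)

theorem proposition3p4:
  fixes V \<psi> :: "real \<Rightarrow> real" and T :: l2_op
  assumes "V \<in> potentials"
    and "is_psi_V V \<psi>"
    and "is_sqrt_op (schroedinger_op V) T"
  shows "\<exists>C > 0. \<forall>f g. (f, g) \<in> T \<and> integrable (density lborel (\<lambda>x. ennreal (\<psi> x))) f \<longrightarrow>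
           l2_norm f powr (2 + 4 / 3)
             \<le> C * l1_norm (\<lambda>x. \<psi> x * f x) powr (4 / 3) * (l2_norm g)\<^sup>2"
proof -
  have sa: "selfadjoint_op T" using assms(3) by (auto simp: is_sqrt_op_def)
  obtain a b e where "a < b" "0 < e" "\<forall>x\<in>{a..b}. e \<le> V x"
    using potential_positive_interval[OF assms(1)] by blast
  then have "0 < V a" by force
  then obtain c where c: "0 < c" "\<And>x. c * (1 + \<bar>x\<bar>) \<le> \<psi> x"
    using psi_V_linear_growth[OF assms(1,2)] by blast
  have pos: "0 \<le> \<psi> x" for x using c(1) c(2)[of x] by (smt (verit) mult_nonneg_nonneg)
  obtain K where K: "0 < K"
    "\<And>f g. (f, g) \<in> T \<Longrightarrow> AE x in lborel. (f x)\<^sup>2 \<le> K * (1 + \<bar>x\<bar>) * (LINT x|lborel. (g x)\<^sup>2)"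
    using sqrt_op_pointwise_bound[OF assms(1,3)] by blast
  define C where "C = (2 * K + sqrt K / c) powr (5 / 3)"
  have "0 < 2 * K + sqrt K / c" using K(1) c(1) by (auto intro!: add_pos_pos)
  then have C: "0 < C" by (simp add: C_def)
  have "l2_norm f powr (2 + 4 / 3) \<le> C * l1_norm (\<lambda>x. \<psi> x * f x) powr (4 / 3) * (l2_norm g)\<^sup>2"
    if fg: "(f, g) \<in> T" and int: "integrable (density lborel (\<lambda>x. ennreal (\<psi> x))) f" for f g
  proof -
    note f = selfadjoint_op_L2(1)[OF sa fg]
    have "integrable lborel (\<lambda>x. \<psi> x * f x)"
      using int integrable_density[of f lborel \<psi>] L2D(1)[OF f] psi_V_measurable[OF assms(2)] pos by simp
    from nash_from_pointwise_bound[OF f c(2,1) this K(1) _ K(2)[OF fg]]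
    have "(LINT x|lborel. (f x)\<^sup>2) powr (5 / 3) \<le> C * l1_norm (\<lambda>x. \<psi> x * f x) powr (4 / 3) * (LINT x|lborel. (g x)\<^sup>2)"
      unfolding C_def by simp
    moreover have "l2_norm f powr (2 + 4 / 3) = (LINT x|lborel. (f x)\<^sup>2) powr (5 / 3)"
      by (simp add: l2_norm_def powr_half_sqrt[symmetric] powr_powr)
    moreover have "(l2_norm g)\<^sup>2 = (LINT x|lborel. (g x)\<^sup>2)" by (simp add: l2_norm_def)
    ultimately show ?thesis by simp
  qed
  then show ?thesis using C by blast
qed

end
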